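(* For any integer $k \ge 2$, $c_k = s_k$.
   Context: Let $\mathcal{C}$ be the unit circle in $\mathbb{R}^2$ centered at the origin, let $R=(1,0)$, and let $d(\cdot,\cdot)$ denote Euclidean distance. For $k\in\mathbb{N}$ and $(T_1,\dots,T_k)\in\mathcal{C}^k$ define $$C(T_1,\dots,T_k)=\min_\sigma\Big(d(R,T_{\sigma(1)})+\sum_{i=2}^k d(T_{\sigma(i-1)},T_{\sigma(i)})\Big),$$ the minimum being over all permutations $\sigma$ of $\{1,\dots,k\}$, and $$c_k=\sup_{(T_1,\dots,T_k)\in\mathcal{C}^k}C(T_1,\dots,T_k).$$ For an integer $k\ge 2$ let $$m_k=\frac{\pi}{2^{\lfloor k/2\rfloor-1}(k-2\lfloor k/2\rfloor+3)-1},\qquad M_k=\frac{2\pi}{k+1}.$$ For $\alpha\in[m_k,M_k)$ let $j=j(k,\alpha)$ be the unique integer in $\{1,2,\dots,\lfloor k/2\rfloor\}$ satisfying $$\frac{2\pi}{2^j(k-2j+3)-2}\le\alpha<\frac{2\pi}{2^{j-1}(k-2(j-1)+3)-2},$$ and for $\alpha=M_k$ set $j=1$. Define $$s_k=\max_{m_k\le\alpha\le M_k}\left(4\sum_{\ell=1}^{j}\sin\left(2^{\ell-2}\alpha\right)+2(k-2j+1)\sin\left(\frac{\pi-(2^j-1)\alpha}{k+1-2j}\right)-2\sin(\alpha/2)\right),\qquad j=j(k,\alpha).$$ *)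

theory Defs
  imports "HOL-Analysis.Analysis" "HOL-Combinatorics.Permutations"
begin

definition unit_circle :: "(real ^ 2) set" where
  "unit_circle = sphere 0 1"

definition base_point :: "real ^ 2" where
  "base_point = vector [1, 0]"

definition path_length :: "nat \<Rightarrow> (nat \<Rightarrow> real ^ 2) \<Rightarrow> (nat \<Rightarrow> nat) \<Rightarrow> real" where
  "path_length k T \<sigma> =
     dist base_point (T (\<sigma> 1)) + (\<Sum>i = 2..k. dist (T (\<sigma> (i - 1))) (T (\<sigma> i)))"

definition min_path :: "nat \<Rightarrow> (nat \<Rightarrow> real ^ 2) \<Rightarrow> real" where
  "min_path k T = Min (path_length k T ` {\<sigma>. \<sigma> permutes {1..k}})"

definition c_sup :: "nat \<Rightarrow> real" where
  "c_sup k = (SUP T \<in> {1..k} \<rightarrow>\<^sub>E unit_circle. min_path k T)"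

definition m_low :: "nat \<Rightarrow> real" where
  "m_low k = pi / (2 ^ (k div 2 - 1) * (real k - 2 * real (k div 2) + 3) - 1)"

definition M_up :: "nat \<Rightarrow> real" where
  "M_up k = 2 * pi / (real k + 1)"

definition j_index :: "nat \<Rightarrow> real \<Rightarrow> nat" where
  "j_index k \<alpha> =
     (if \<alpha> = M_up k then 1
      else (THE j. j \<in> {1..k div 2} \<and>
              2 * pi / (2 ^ j * (real k - 2 * real j + 3) - 2) \<le> \<alpha> \<and>
              \<alpha> < 2 * pi / (2 ^ (j - 1) * (real k - 2 * (real j - 1) + 3) - 2)))"

definition s_fun :: "nat \<Rightarrow> real \<Rightarrow> real" where
  "s_fun k \<alpha> =
     (let j = j_index k \<alpha> in
        4 * (\<Sum>l = 1..j. sin (2 powi (int l - 2) * \<alpha>))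
        + 2 * (real k - 2 * real j + 1) * sin ((pi - (2 ^ j - 1) * \<alpha>) / (real k + 1 - 2 * real j))
        - 2 * sin (\<alpha> / 2))"

text \<open>The maximum is a genuine maximum: the greatest element of the set of values, which is
  only determined if it is attained.\<close>

definition s_max :: "nat \<Rightarrow> real" where
  "s_max k = (GREATEST y. y \<in> s_fun k ` {m_low k..M_up k})"

end

theory Submission imports Defs begin

text \<open>Lower bound: place the points so that the gaps on either side of the base point are
  \<open>\<alpha>, 2\<alpha>, 4\<alpha>, \<dots>, 2\<^sup>j\<^sup>-\<^sup>1\<alpha>\<close>, all others being equal. A shortest path does not cross itself, hence it always
  visits an interval around the base point and extends it at one of its ends; a switch between the
  ends costs at least the gap that is left open, so the full circuit without one \<open>\<alpha>\<close>-gap is optimal.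

  Upper bound: consider the paths that take \<open>b\<close> steps to one side and then go round the other way.
  Averaging with the mirror image and concavity of the chord length reduce to symmetric gaps
  \<open>z\<^sub>0, z\<^sub>1, \<dots>\<close>. For symmetric gaps maximising the shortest of these paths, a perturbation argument gives
  \<open>z\<^sub>b \<le> z\<^sub>0 + (z\<^sub>0 + \<dots> + z\<^sub>b\<^sub>-\<^sub>1)\<close>, so \<open>z\<^sub>b \<le> 2\<^sup>b z\<^sub>0\<close>, and by concavity the best choice under this
  constraint is the configuration above with \<open>\<alpha> = z\<^sub>0\<close> (or the regular polygon if \<open>z\<^sub>0\<close> is too large).\<close>

subsection \<open>Shortest paths without crossings\<close>

text \<open>Index 0 stands for the base point: permutations of \<open>{1..k}\<close> fix 0, so each
  of them describes a path starting there. An abstract \<open>d\<close> keeps the exchange argument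
  free of geometry.\<close>

definition route_len :: "(nat \<Rightarrow> nat \<Rightarrow> real) \<Rightarrow> nat \<Rightarrow> (nat \<Rightarrow> nat) \<Rightarrow> real" where
  "route_len d k v = (\<Sum>i<k. d (v i) (v (Suc i)))"

lemma reversal_permutes:
  assumes "i < j" "j \<le> k"
  shows "(\<lambda>l. if Suc i \<le> l \<and> l \<le> j then Suc (i + j) - l else l) permutes {1..k::nat}"
proof (rule permutes_subset)
  show "(\<lambda>l. if Suc i \<le> l \<and> l \<le> j then Suc (i + j) - l else l) permutes {Suc i..j}"
    by (rule bij_imp_permutes, rule bij_betw_byWitness[where f' = "\<lambda>l. Suc (i + j) - l"])
       (use assms in auto)
qed (use assms in auto)

text \<open>Reversing positions \<open>Suc i\<close> to \<open>j\<close> keeps the inner edges of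
  the segment, by symmetry of \<open>d\<close>, and replaces only the two edges at its ends.\<close>

lemma route_len_reversal:
  assumes sym: "\<And>x y. d x y = d y x" and "i < j" "j < k"
  defines "r \<equiv> (\<lambda>l. if Suc i \<le> l \<and> l \<le> j then Suc (i + j) - l else l)"
  shows "route_len d k (v \<circ> r) =
    route_len d k v - d (v i) (v (Suc i)) - d (v j) (v (Suc j)) + d (v i) (v j) + d (v (Suc i)) (v (Suc j))"
proof -
  have split: "(\<Sum>l<k. f l) = (\<Sum>l<i. f l) + f i + (\<Sum>l=Suc i..<j. f l) + f j + (\<Sum>l=Suc j..<k. f l)"
    for f :: "nat \<Rightarrow> real"
    using assms sum.atLeastLessThan_concat[of 0 i k f] sum.atLeastLessThan_concat[of "Suc i" j k f]
      sum.atLeast_Suc_lessThan[of i k f] sum.atLeast_Suc_lessThan[of j k f]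
    by (simp add: lessThan_atLeast0)
  have mid: "(\<Sum>l=Suc i..<j. d (v (r l)) (v (r (Suc l)))) = (\<Sum>l=Suc i..<j. d (v l) (v (Suc l)))"
    by (rule sum.reindex_bij_witness[where i = "\<lambda>l. i + j - l" and j = "\<lambda>l. i + j - l"])
       (auto simp: r_def sym Suc_diff_le)
  have "(\<Sum>l<i. d (v (r l)) (v (r (Suc l)))) = (\<Sum>l<i. d (v l) (v (Suc l)))"
    "(\<Sum>l=Suc j..<k. d (v (r l)) (v (r (Suc l)))) = (\<Sum>l=Suc j..<k. d (v l) (v (Suc l)))"
    using assms(2) by (auto simp: r_def intro!: sum.cong)
  moreover have "r i = i" "r (Suc i) = j" "r j = Suc i" "r (Suc j) = Suc j"
    using assms by (auto simp: r_def)
  ultimately show ?thesis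
    unfolding route_len_def o_def split[of "\<lambda>l. d (v (r l)) (v (r (Suc l)))"]
      split[of "\<lambda>l. d (v l) (v (Suc l))"] mid by simp
qed

lemma shortest_no_crossing:
  assumes sym: "\<And>x y. d x y = d y x" 
    and v: "v permutes {1..k}" and min: "\<And>\<sigma>. \<sigma> permutes {1..k} \<Longrightarrow> route_len d k v \<le> route_len d k \<sigma>"
    and "i < j" "j < k"
  shows "d (v i) (v (Suc i)) + d (v j) (v (Suc j)) \<le> d (v i) (v j) + d (v (Suc i)) (v (Suc j))"
  using min[OF permutes_compose[OF reversal_permutes[of i j k] v]] route_len_reversal[of d, OF sym assms(4,5), of v]
    assms(4,5) by simp

text \<open>If the next point were not adjacent to the visited interval, the remaining path would have to
  cross the edge leading to it, as there are unvisited points on both sides.\<close>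

lemma interval_step_adjacent:
  assumes sym: "\<And>x y. d x y = d y x"
    and cross1: "\<And>p q r s. p < q \<Longrightarrow> q < r \<Longrightarrow> r < s \<Longrightarrow> s \<le> k \<Longrightarrow> d p q + d r s < d p r + d q s"
    and cross2: "\<And>p q r s. p < q \<Longrightarrow> q < r \<Longrightarrow> r < s \<Longrightarrow> s \<le> k \<Longrightarrow> d p s + d q r < d p r + d q s"
    and v: "v permutes {1..k}" and min: "\<And>\<sigma>. \<sigma> permutes {1..k} \<Longrightarrow> route_len d k v \<le> route_len d k \<sigma>"
    and m: "m < k" and vis: "v ` {..m} = {..<lo} \<union> {hi<..k}"
    and lohi: "lo \<le> hi" "hi \<le> k"
    and cur: "v m < lo \<or> hi < v m"
  shows "v (Suc m) = lo \<or> v (Suc m) = hi"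
proof (rule ccontr)
  assume neg: "\<not> ?thesis"
  define x where "x = v (Suc m)"
  have inj: "inj v" using v by (rule permutes_inj)
  have im: "v ` {..k} = {..k}"
  proof -
    have "v ` {1..k} = {1..k}" using v by (rule permutes_image)
    moreover have "v 0 = 0" using v by (rule permutes_not_in) simp
    moreover have "{..k} = insert 0 {1..k}" by auto
    ultimately show ?thesis by simp
  qed
  have later: "v l \<in> {lo..hi}" if "m < l" "l \<le> k" for l
  proof -
    have "v l \<notin> v ` {..m}" using that inj by (simp add: inj_image_mem_iff)
    moreover have "v l \<in> {..k}" using that im by blast
    ultimately show ?thesis unfolding vis by auto
  qed
  have xr: "lo < x" "x < hi" using later[of "Suc m"] neg m unfolding x_def by auto
  have hit: "\<exists>l. Suc m < l \<and> l \<le> k \<and> v l = y" if y: "y \<in> {lo..hi}" "y \<noteq> x" for y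
  proof -
    have "y \<in> v ` {..k}" using y(1) lohi unfolding im by auto
    then obtain l where l: "l \<le> k" "v l = y" by auto
    have "y \<notin> v ` {..m}" using y(1) unfolding vis by auto
    then have "l \<notin> {..m}" using l(2) by blast
    moreover have "l \<noteq> Suc m" using l y(2) unfolding x_def by auto
    ultimately show ?thesis using l by (intro exI[of _ l]) auto
  qed
  have ne: "v l \<noteq> x" if "Suc m < l" for l using that inj unfolding x_def by (simp add: inj_eq)
  \<comment> \<open>Both \<open>lo\<close> and \<open>hi\<close> are still to be visited and lie on
    different sides of \<open>x\<close>, so some later edge passes over \<open>x\<close>.\<close>
  obtain l where l: "Suc m < l" "Suc l \<le> k" "(v l < x) \<noteq> (v (Suc l) < x)"
  proof (rule ccontr)
    assume "\<not> thesis"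
    then have const: "Suc m < l \<Longrightarrow> Suc l \<le> k \<Longrightarrow> (v l < x) = (v (Suc l) < x)" for l
      using that by blast
    have all: "l \<le> k \<Longrightarrow> (v l < x) = (v (Suc (Suc m)) < x)" if "Suc (Suc m) \<le> l" for l
      using that by (induction l rule: dec_induct) (use const in auto)
    obtain l1 where "Suc m < l1" "l1 \<le> k" "v l1 = lo" using hit[of lo] xr by auto
    moreover obtain l2 where "Suc m < l2" "l2 \<le> k" "v l2 = hi" using hit[of hi] xr by auto
    ultimately show False using all[of l1] all[of l2] xr by auto
  qed
  define y y' where "y = v l" and "y' = v (Suc l)"
  have in1: "lo \<le> y" "y \<le> hi" "lo \<le> y'" "y' \<le> hi" using later[of l] later[of "Suc l"] l unfolding y_def y'_def by auto
  have neq: "y \<noteq> x" "y' \<noteq> x" using ne[of l] ne[of "Suc l"] l unfolding y_def y'_def by auto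
  have vmk: "v m \<le> k" 
  proof -
    have "v m \<in> v ` {..k}" using m by auto
    then show ?thesis unfolding im by simp
  qed
  have opt: "d (v m) x + d y y' \<le> d (v m) y + d x y'"
    using shortest_no_crossing[of d v k m l, OF sym v min] l unfolding x_def y_def y'_def by auto
  \<comment> \<open>In all four cases the edges from \<open>v m\<close> to \<open>x\<close> and from
    \<open>y\<close> to \<open>y'\<close> are the diagonals of their quadrilateral, while
    \<open>opt\<close> makes them no longer than two opposite sides. The order of the points decides
    between \<open>cross1\<close> and \<open>cross2\<close>.\<close>
  consider "y < x" "x < y'" | "y' < x" "x < y" using l(3) neq unfolding y_def y'_def by linarith
  then show False
  proof cases
    case 1
    show False using cur
    proof
      assume "v m < lo"
      then show False using cross1[of "v m" y x y'] opt 1 in1 lohi by (auto simp: sym)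
    next
      assume "hi < v m"
      then show False using cross2[of y x y' "v m"] opt 1 in1 vmk by (auto simp: sym)
    qed
  next
    case 2
    show False using cur
    proof
      assume "v m < lo"
      then show False using cross2[of "v m" y' x y] opt 2 in1 lohi by (auto simp: sym)
    next
      assume "hi < v m"
      then show False using cross1[of y' x y "v m"] opt 2 in1 vmk by (auto simp: sym)
    qed
  qed
qed

text \<open>The bound is the length of the route 0, 1, ..., \<open>k\<close>. Geometry enters only
  through the order of the points: diagonals beat both pairs of opposite sides
  (\<open>cross1\<close>, \<open>cross2\<close>), and a jump costs at least the gap it leaves open
  (\<open>right\<close>, \<open>left\<close>).\<close>

lemma shortest_ge:
  assumes sym: "\<And>x y. d x y = d y x"
    and cross1: "\<And>p q r s. p < q \<Longrightarrow> q < r \<Longrightarrow> r < s \<Longrightarrow> s \<le> k \<Longrightarrow> d p q + d r s < d p r + d q s"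
    and cross2: "\<And>p q r s. p < q \<Longrightarrow> q < r \<Longrightarrow> r < s \<Longrightarrow> s \<le> k \<Longrightarrow> d p s + d q r < d p r + d q s"
    and v: "v permutes {1..k}" and min: "\<And>\<sigma>. \<sigma> permutes {1..k} \<Longrightarrow> route_len d k v \<le> route_len d k \<sigma>"
    and gap: "\<And>i. i < k \<Longrightarrow> d i (Suc i) = h i"
    and right: "\<And>i j. i < j \<Longrightarrow> j \<le> k \<Longrightarrow> h i \<le> d i j"
    and left: "\<And>i j. 0 < i \<Longrightarrow> i \<le> j \<Longrightarrow> j < k \<Longrightarrow> h j \<le> d i (Suc j)"
  shows "(\<Sum>i<k. h i) \<le> route_len d k v"
proof -
  have v0: "v 0 = 0" using v by (rule permutes_not_in) simp
  \<comment> \<open>Points up to \<open>b\<close> and beyond \<open>c\<close> are visited; the path has paid for all visited gaps and, up to the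
    constant \<open>h k\<close>, also for the next gap at the end where it is not. A jump to the other end costs at
    least the gap it leaves behind, so this is preserved.\<close>
  have inv: "\<exists>b c. b \<le> c \<and> c \<le> k \<and> v ` {..m} = {..b} \<union> {c<..k} \<and> b + k = c + m \<and>
     ((v m = b \<and> (\<Sum>i<b. h i) + (\<Sum>i=Suc c..k. h i) + h c - h k \<le> route_len d m v) \<or>
      (v m = Suc c \<and> c < k \<and> (\<Sum>i<b. h i) + (\<Sum>i=Suc c..k. h i) + h b - h k \<le> route_len d m v))"
    if "m \<le> k" for m
    using that
  proof (induction m)
    case 0
    show ?case by (rule exI[of _ 0], rule exI[of _ k]) (auto simp: v0 route_len_def)
  next
    case (Suc m)
    then obtain b c where bc: "b \<le> c" "c \<le> k" and im: "v ` {..m} = {..b} \<union> {c<..k}" and cm: "b + k = c + m"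
      and st: "(v m = b \<and> (\<Sum>i<b. h i) + (\<Sum>i=Suc c..k. h i) + h c - h k \<le> route_len d m v) \<or>
      (v m = Suc c \<and> c < k \<and> (\<Sum>i<b. h i) + (\<Sum>i=Suc c..k. h i) + h b - h k \<le> route_len d m v)" by auto
    have blc: "b < c" using Suc.prems cm by linarith
    have "v (Suc m) = Suc b \<or> v (Suc m) = c"
      by (rule interval_step_adjacent[where d = d and k = k and m = m, OF sym cross1 cross2 v min])
        (use Suc.prems im bc blc st in auto)
    moreover have imS: "v ` {..Suc m} = insert (v (Suc m)) ({..b} \<union> {c<..k})"
      using im by (simp add: atMost_Suc)
    have T: "route_len d (Suc m) v = route_len d m v + d (v m) (v (Suc m))" by (simp add: route_len_def)
    have sumc: "(\<Sum>i=c..k. h i) = h c + (\<Sum>i=Suc c..k. h i)" using bc by (simp add: sum.atLeast_Suc_atMost)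
    have c0: "c = Suc (c - 1)" using blc by simp
    have right': "v (Suc m) = Suc b \<Longrightarrow> ?case"
    proof -
      assume x: "v (Suc m) = Suc b"
      have A: "Suc b \<le> c" "c \<le> k" "v ` {..Suc m} = {..Suc b} \<union> {c<..k}" "Suc b + k = c + Suc m"
        using blc bc cm unfolding imS x by auto
      have "(\<Sum>i<Suc b. h i) + (\<Sum>i=Suc c..k. h i) + h c - h k \<le> route_len d (Suc m) v"
        using st
      proof
        assume "v m = b \<and> (\<Sum>i<b. h i) + (\<Sum>i=Suc c..k. h i) + h c - h k \<le> route_len d m v"
        then show ?thesis using gap[of b] blc bc unfolding T x by auto
      next
        assume "v m = Suc c \<and> c < k \<and> (\<Sum>i<b. h i) + (\<Sum>i=Suc c..k. h i) + h b - h k \<le> route_len d m v"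
        then show ?thesis using left[of "Suc b" c] blc bc sym[of "Suc c" "Suc b"] unfolding T x by auto
      qed
      then show ?case using A x by blast
    qed
    have left': "v (Suc m) = c \<Longrightarrow> ?case"
    proof -
      assume x: "v (Suc m) = c"
      have A: "b \<le> c - 1" "c - 1 \<le> k" "v ` {..Suc m} = {..b} \<union> {c-1<..k}" "b + k = c - 1 + Suc m"
        "c - 1 < k" "v (Suc m) = Suc (c - 1)"
        using blc bc cm unfolding imS x by auto
      have "(\<Sum>i<b. h i) + (\<Sum>i=Suc (c - 1)..k. h i) + h b - h k \<le> route_len d (Suc m) v"
        using st
      proof
        assume "v m = b \<and> (\<Sum>i<b. h i) + (\<Sum>i=Suc c..k. h i) + h c - h k \<le> route_len d m v"
        then show ?thesis using right[of b c] blc bc unfolding T x c0[symmetric] sumc by auto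
      next
        assume "v m = Suc c \<and> c < k \<and> (\<Sum>i<b. h i) + (\<Sum>i=Suc c..k. h i) + h b - h k \<le> route_len d m v"
        then show ?thesis using gap[of c] sym[of "Suc c" c] unfolding T x c0[symmetric] sumc by auto
      qed
      then show ?case using A by blast
    qed
    ultimately show ?case using right' left' by blast
  qed
  \<comment> \<open>At \<open>m = k\<close> the relation \<open>b + k = c + m\<close> forces
    \<open>c = b\<close>: all points are visited, and the gap paid in advance is the only one
    outside the two sums.\<close>
  obtain b where b: "b \<le> k" "(\<Sum>i<b. h i) + (\<Sum>i=Suc b..k. h i) + h b - h k \<le> route_len d k v"
    using inv[of k] by auto
  have "(\<Sum>i\<le>k. h i) = (\<Sum>i<b. h i) + h b + (\<Sum>i=Suc b..k. h i)"
    using b(1) sum.atLeastLessThan_concat[of 0 b "Suc k" h] sum.atLeast_Suc_lessThan[of b "Suc k" h]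
    by (simp add: lessThan_atLeast0 lessThan_Suc_atMost[symmetric] atLeastLessThanSuc_atLeastAtMost[symmetric])
  moreover have "(\<Sum>i\<le>k. h i) = (\<Sum>i<k. h i) + h k" by (simp add: lessThan_Suc_atMost[symmetric])
  ultimately show ?thesis using b by simp
qed

subsection \<open>Chords\<close>

text \<open>For \<open>t\<close> between 0 and \<open>2 * pi\<close>, the length of the chord over
  an arc of angle \<open>t\<close>.\<close>

definition chord :: "real \<Rightarrow> real" where
  "chord t = 2 * sin (t / 2)"

definition circle_point :: "real \<Rightarrow> real ^ 2" where
  "circle_point t = vector [cos t, sin t]"

text \<open>The product form lets signs be read off factor by factor; monotonicity and both crossing
  inequalities rest on it.\<close>

lemma chord_diff: "chord y - chord x = 4 * sin ((y - x) / 4) * cos ((x + y) / 4)"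
  by (simp add: chord_def right_diff_distrib[symmetric] sin_diff_sin field_simps)

text \<open>Since \<open>chord\<close> is symmetric about \<open>pi\<close>, the condition on
  \<open>x + y\<close> suffices and allows \<open>y\<close> to exceed \<open>pi\<close>: both the
  arc \<open>y\<close> and its complement must be at least \<open>x\<close>.\<close>

lemma chord_mono:
  assumes "0 \<le> x" "x \<le> y" "x + y \<le> 2 * pi"
  shows "chord x \<le> chord y"
proof -
  have "0 \<le> sin ((y - x) / 4)" using assms by (intro sin_ge_zero) auto
  moreover have "0 \<le> cos ((x + y) / 4)" using assms by (intro cos_ge_zero) auto
  ultimately have "0 \<le> chord y - chord x" by (simp add: chord_diff)
  then show ?thesis by simp
qed

lemma chord_strict_mono:
  assumes "0 \<le> x" "x < y" "x + y < 2 * pi"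
  shows "chord x < chord y"
proof -
  have "0 < sin ((y - x) / 4)" using assms by (intro sin_gt_zero) auto
  moreover have "0 < cos ((x + y) / 4)" using assms by (intro cos_gt_zero_pi) auto
  ultimately have "0 < chord y - chord x" by (simp add: chord_diff)
  then show ?thesis by simp
qed

lemma chord_reflect: "chord (2 * pi - t) = chord t"
  by (simp add: chord_def diff_divide_distrib sin_diff)

text \<open>Diagonals of an inscribed quadrilateral against the sides \<open>pq\<close> and
  \<open>rs\<close>. Pairing each diagonal with a side gives two differences with the common factor
  \<open>sin ((r - q) / 4)\<close>, and the remaining cosines have a positive sum.\<close>

lemma chord_crossing_sides:
  assumes "p < q" "q < r" "r < s" "s - p < 2 * pi"
  shows "chord (q - p) + chord (s - r) < chord (r - p) + chord (s - q)"
proof -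
  have "chord (r - p) - chord (q - p) = 4 * sin ((r - q) / 4) * cos ((q + r - 2 * p) / 4)"
  proof -
    have "(r - p) - (q - p) = r - q" "(q - p) + (r - p) = q + r - 2 * p" by simp_all
    then show ?thesis by (simp only: chord_diff)
  qed
  moreover have "chord (s - q) - chord (s - r) = 4 * sin ((r - q) / 4) * cos ((2 * s - q - r) / 4)"
  proof -
    have "(s - q) - (s - r) = r - q" "(s - r) + (s - q) = 2 * s - q - r" by simp_all
    then show ?thesis by (simp only: chord_diff)
  qed
  moreover have "cos ((q + r - 2 * p) / 4) + cos ((2 * s - q - r) / 4) =
      2 * cos ((s - p) / 4) * cos ((q + r - p - s) / 4)"
  proof -
    have "((q + r - 2 * p) / 4 + (2 * s - q - r) / 4) / 2 = (s - p) / 4"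
      "((q + r - 2 * p) / 4 - (2 * s - q - r) / 4) / 2 = (q + r - p - s) / 4" by (simp_all add: field_simps)
    then show ?thesis by (simp only: cos_plus_cos)
  qed
  moreover have "0 < sin ((r - q) / 4)" using assms by (intro sin_gt_zero) auto
  moreover have "0 < cos ((s - p) / 4)" "0 < cos ((q + r - p - s) / 4)"
    using assms by (intro cos_gt_zero_pi; simp)+
  ultimately have "0 < (chord (r - p) - chord (q - p)) + (chord (s - q) - chord (s - r))"
    by (simp add: distrib_left[symmetric])
  then show ?thesis by simp
qed

text \<open>The same for the other two sides, \<open>ps\<close> and \<open>qr\<close>; here the
  common factor is \<open>sin ((s - r) / 4)\<close>.\<close>

lemma chord_crossing_outer:
  assumes "p < q" "q < r" "r < s" "s - p < 2 * pi"
  shows "chord (s - p) + chord (r - q) < chord (r - p) + chord (s - q)"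
proof -
  have "chord (s - p) - chord (r - p) = 4 * sin ((s - r) / 4) * cos ((r + s - 2 * p) / 4)"
  proof -
    have "(s - p) - (r - p) = s - r" "(r - p) + (s - p) = r + s - 2 * p" by simp_all
    then show ?thesis by (simp only: chord_diff)
  qed
  moreover have "chord (s - q) - chord (r - q) = 4 * sin ((s - r) / 4) * cos ((r + s - 2 * q) / 4)"
  proof -
    have "(s - q) - (r - q) = s - r" "(r - q) + (s - q) = r + s - 2 * q" by simp_all
    then show ?thesis by (simp only: chord_diff)
  qed
  moreover have "cos ((r + s - 2 * q) / 4) - cos ((r + s - 2 * p) / 4) =
      2 * sin ((r + s - p - q) / 4) * sin ((q - p) / 4)"
  proof -
    have "((r + s - 2 * q) / 4 + (r + s - 2 * p) / 4) / 2 = (r + s - p - q) / 4"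
      "((r + s - 2 * p) / 4 - (r + s - 2 * q) / 4) / 2 = (q - p) / 4" by (simp_all add: field_simps)
    then show ?thesis by (simp only: cos_diff_cos)
  qed
  moreover have "0 < sin ((s - r) / 4)" "0 < sin ((r + s - p - q) / 4)" "0 < sin ((q - p) / 4)"
    using assms by (intro sin_gt_zero; simp)+
  ultimately have "0 < (chord (s - q) - chord (r - q)) - (chord (s - p) - chord (r - p))"
    by (simp add: right_diff_distrib[symmetric])
  then show ?thesis by simp
qed

section \<open>Points of the circle and their angles\<close>

lemma dist_circle_point: "dist (circle_point s) (circle_point t) = 2 * \<bar>sin ((s - t) / 2)\<bar>"
proof -
  have "(cos s - cos t)\<^sup>2 + (sin s - sin t)\<^sup>2 = 2 - 2 * (cos s * cos t + sin s * sin t)"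
    using sin_cos_squared_add[of s] sin_cos_squared_add[of t]
    by (simp add: power2_diff algebra_simps)
  also have "cos s * cos t + sin s * sin t = cos (2 * ((s - t) / 2))"
    unfolding cos_diff[symmetric] by (rule arg_cong[of _ _ cos]) simp
  also have "2 - 2 * cos (2 * ((s - t) / 2)) = (2 * sin ((s - t) / 2))\<^sup>2"
    unfolding cos_double_sin by (simp add: power_mult_distrib)
  finally show ?thesis
    by (simp add: dist_norm norm_vec_def L2_set_def sum_2 circle_point_def real_sqrt_mult)
qed

lemma dist_circle_point_chord:
  assumes "s \<le> t" "t - s \<le> 2 * pi"
  shows "dist (circle_point s) (circle_point t) = chord (t - s)"
proof -
  have "0 \<le> sin ((t - s) / 2)" using assms by (intro sin_ge_zero) auto
  then show ?thesis by (subst dist_commute) (simp add: dist_circle_point chord_def)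
qed

lemma circle_point_0: "circle_point 0 = base_point"
  by (simp add: circle_point_def base_point_def)

lemma circle_point_in_circle: "circle_point t \<in> unit_circle"
  by (simp add: unit_circle_def circle_point_def norm_vec_def L2_set_def sum_2)

lemma unit_circle_angle:
  assumes "x \<in> unit_circle"
  obtains t where "0 \<le> t" "t < 2 * pi" "x = circle_point t"
proof -
  have "(x $ 1)\<^sup>2 + (x $ 2)\<^sup>2 = 1"
    using assms by (simp add: unit_circle_def norm_vec_def L2_set_def sum_2)
  then obtain t where "0 \<le> t" "t < 2 * pi" "x $ 1 = cos t" "x $ 2 = sin t"
    by (rule sincos_total_2pi)
  then show thesis by (intro that[of t]) (auto simp: circle_point_def vec_eq_iff forall_2)
qed

text \<open>Storing the base point at index 0 turns the special first edge into an ordinary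
  one.\<close>

lemma path_length_route_len:
  assumes "\<sigma> permutes {1..k}" "1 \<le> k"
  shows "path_length k T \<sigma> = route_len (\<lambda>i j. dist ((T(0 := base_point)) i) ((T(0 := base_point)) j)) k \<sigma>"
proof -
  let ?d = "\<lambda>i. dist ((T(0 := base_point)) (\<sigma> i)) ((T(0 := base_point)) (\<sigma> (Suc i)))"
  have s0: "\<sigma> 0 = 0" using assms(1) by (rule permutes_not_in) simp
  have pos: "\<sigma> i \<noteq> 0" if "0 < i" for i using permutes_inj[OF assms(1)] s0 that by (metis inj_eq less_irrefl)
  have "{..<k} = insert 0 {1..<k}" using assms(2) by auto
  then have "(\<Sum>i<k. ?d i) = ?d 0 + (\<Sum>i=1..<k. ?d i)" by simp
  also have "(\<Sum>i=1..<k. ?d i) = (\<Sum>i=2..k. dist (T (\<sigma> (i - 1))) (T (\<sigma> i)))"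
    by (rule sum.reindex_bij_witness[where i = "\<lambda>i. i - 1" and j = Suc]) (auto simp: pos)
  finally show ?thesis using s0 pos[of 1] by (simp add: path_length_def route_len_def)
qed

lemma min_path_le:
  assumes "\<sigma> permutes {1..k}"
  shows "min_path k T \<le> path_length k T \<sigma>"
  unfolding min_path_def using assms by (intro Min_le) (auto simp: finite_permutations)

lemma min_path_attained:
  obtains \<sigma> where "\<sigma> permutes {1..k}" "min_path k T = path_length k T \<sigma>"
proof -
  have "min_path k T \<in> path_length k T ` {\<sigma>. \<sigma> permutes {1..k}}"
    unfolding min_path_def
    by (intro Min_in) (auto simp: finite_permutations intro: permutes_id)
  then show thesis using that by auto
qed

text \<open>Here \<open>g i\<close> is the arc from point \<open>i\<close> to the next one and
  \<open>g k\<close> closes the circle. The hypotheses \<open>right\<close> and \<open>left\<close>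
  bound \<open>g i\<close> by the arc on the far side of a jump, so the chord of the jump is at
  least that of the gap left open, whichever arc is shorter.\<close>

lemma min_path_ge_of_gaps:
  fixes g :: "nat \<Rightarrow> real"
  assumes k: "1 \<le> k" and pos: "\<And>i. i \<le> k \<Longrightarrow> 0 < g i" and tot: "(\<Sum>i\<le>k. g i) = 2 * pi"
    and right: "\<And>i. i \<le> k \<Longrightarrow> g i \<le> g k + (\<Sum>l<i. g l)"
    and left: "\<And>i. i \<le> k \<Longrightarrow> g i \<le> g 0 + (\<Sum>l=Suc i..k. g l)"
    and T: "\<And>i. i \<in> {1..k} \<Longrightarrow> T i = circle_point (\<Sum>l<i. g l)"
  shows "(\<Sum>i<k. chord (g i)) \<le> min_path k T"
proof -
  define \<theta> where "\<theta> i = (\<Sum>l<i. g l)" for i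
  let ?P = "T(0 := base_point)"
  let ?d = "\<lambda>i j. dist (?P i) (?P j)"
  have P: "?P i = circle_point (\<theta> i)" if "i \<le> k" for i
    using T[of i] that by (auto simp: \<theta>_def circle_point_0)
  have diff: "\<theta> j - \<theta> i = (\<Sum>l=i..<j. g l)" if "i \<le> j" for i j
    using sum.atLeastLessThan_concat[of 0 i j g] that by (simp add: \<theta>_def lessThan_atLeast0)
  have rest: "2 * pi - \<theta> i = (\<Sum>l=i..k. g l)" if "i \<le> Suc k" for i
    using sum.atLeastLessThan_concat[of 0 i "Suc k" g] that tot
    by (simp add: \<theta>_def lessThan_atLeast0 lessThan_Suc_atMost[symmetric] atLeastLessThanSuc_atLeastAtMost[symmetric])
  have part: "g l \<le> (\<Sum>i=a..<b. g i)" if "a \<le> l" "l < b" "b \<le> Suc k" for a b l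
    using that pos by (intro member_le_sum) (auto intro: less_imp_le)
  have part': "g l \<le> (\<Sum>i=a..k. g i)" if "a \<le> l" "l \<le> k" for a l
    using that pos by (intro member_le_sum) (auto intro: less_imp_le)
  have mono: "\<theta> i < \<theta> j" if "i < j" "j \<le> k" for i j
    using part[of i i j] diff[of i j] pos[of i] that by auto
  have th0: "0 \<le> \<theta> i" if "i \<le> k" for i unfolding \<theta>_def using that by (intro sum_nonneg less_imp_le pos) auto
  have th2: "\<theta> i < 2 * pi" if "i \<le> k" for i using rest[of i] part'[of i i] pos[of i] that by auto
  have d: "?d i j = chord (\<theta> j - \<theta> i)" if "i < j" "j \<le> k" for i j
    using mono[OF that] th0[of i] th2[of j] that by (simp only: P) (intro dist_circle_point_chord; simp)
  obtain \<sigma> where \<sigma>: "\<sigma> permutes {1..k}" "min_path k T = path_length k T \<sigma>"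
    by (rule min_path_attained)
  have "(\<Sum>i<k. chord (g i)) \<le> route_len ?d k \<sigma>"
  proof (rule shortest_ge[OF _ _ _ \<sigma>(1)])
    show "?d x y = ?d y x" for x y by (rule dist_commute)
    show "?d p q + ?d r s < ?d p r + ?d q s" if "p < q" "q < r" "r < s" "s \<le> k" for p q r s
      using chord_crossing_sides[of "\<theta> p" "\<theta> q" "\<theta> r" "\<theta> s"] mono[of p q] mono[of q r] mono[of r s]
        th0[of p] th2[of s] that by (simp add: d del: fun_upd_apply)
    show "?d p s + ?d q r < ?d p r + ?d q s" if "p < q" "q < r" "r < s" "s \<le> k" for p q r s
      using chord_crossing_outer[of "\<theta> p" "\<theta> q" "\<theta> r" "\<theta> s"] mono[of p q] mono[of q r] mono[of r s]
        th0[of p] th2[of s] that by (simp add: d del: fun_upd_apply)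
    show "route_len ?d k \<sigma> \<le> route_len ?d k \<sigma>'" if "\<sigma>' permutes {1..k}" for \<sigma>'
      using min_path_le[OF that, of T] \<sigma> that k by (simp add: path_length_route_len del: fun_upd_apply)
    show "?d i (Suc i) = chord (g i)" if "i < k" for i
      using that diff[of i "Suc i"] by (simp add: d del: fun_upd_apply)
    show "chord (g i) \<le> ?d i j" if "i < j" "j \<le> k" for i j
    proof -
      have "g i \<le> \<theta> j - \<theta> i" using part[of i i j] diff[of i j] that by auto
      moreover have "g k \<le> 2 * pi - \<theta> j" using rest[of j] part'[of j k] that by auto
      ultimately show ?thesis unfolding d[OF that]
        using right[of i] pos[of i] that by (intro chord_mono) (auto simp: \<theta>_def)
    qed
    show "chord (g j) \<le> ?d i (Suc j)" if "0 < i" "i \<le> j" "j < k" for i j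
    proof -
      have "g j \<le> \<theta> (Suc j) - \<theta> i" using part[of i j "Suc j"] diff[of i "Suc j"] that by auto
      moreover have "g 0 \<le> \<theta> i" using part[of 0 0 i] that by (auto simp: \<theta>_def lessThan_atLeast0)
      ultimately show ?thesis using d[of i "Suc j"] rest[of "Suc j"] left[of j] pos[of j] that
        by (auto simp del: fun_upd_apply intro!: chord_mono)
    qed
  qed
  then show ?thesis using \<sigma> k by (simp add: path_length_route_len)
qed

subsection \<open>The extremal configuration\<close>

text \<open>The multiplicity of the \<open>i\<close>-th gap from the base point among the \<open>k + 1\<close> gaps of a symmetric
  configuration: the middle gap is single for even \<open>k\<close>.\<close>

definition sym_weight :: "nat \<Rightarrow> nat \<Rightarrow> real" where
  "sym_weight k i = (if i < k div 2 then 2 else real k + 1 - 2 * real (k div 2))"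

lemma sym_weight_cases:
  "sym_weight k i = 1 \<or> sym_weight k i = 2"
proof -
  have "k = 2 * (k div 2) \<or> k = 2 * (k div 2) + 1" by presburger
  then have "real k = 2 * real (k div 2) \<or> real k = 2 * real (k div 2) + 1"
    by (metis of_nat_1 of_nat_add of_nat_mult of_nat_numeral)
  then show ?thesis unfolding sym_weight_def by auto
qed

text \<open>Folds index \<open>i\<close> onto \<open>k - i\<close>. For even \<open>k\<close> the
  middle index is its own mirror image, which its weight 1 accounts for.\<close>

lemma sum_eq_sym_weight:
  fixes f :: "nat \<Rightarrow> real"
  shows "(\<Sum>i\<le>k. f i) = (\<Sum>i\<le>k div 2. sym_weight k i * ((f i + f (k - i)) / 2))"
proof -
  define n where "n = k div 2"
  have nk: "n \<le> k" unfolding n_def by simp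
  have "(\<Sum>i\<le>k. f i) = (\<Sum>i<Suc n. f i) + (\<Sum>i=Suc n..<Suc k. f i)"
    using sum.atLeastLessThan_concat[of 0 "Suc n" "Suc k" f] nk
    by (simp only: lessThan_atLeast0 lessThan_Suc_atMost[symmetric])
  also have "(\<Sum>i=Suc n..<Suc k. f i) = (\<Sum>i<k - n. f (k - i))"
    by (rule sum.reindex_bij_witness[where i = "\<lambda>i. k - i" and j = "\<lambda>i. k - i"]) auto
  finally have eq: "(\<Sum>i\<le>k. f i) = (\<Sum>i<n. f i) + f n + (\<Sum>i<k - n. f (k - i))" by simp
  have lhs: "(\<Sum>i\<le>n. sym_weight k i * ((f i + f (k - i)) / 2)) =
      (\<Sum>i<n. f i) + (\<Sum>i<n. f (k - i)) + sym_weight k n * ((f n + f (k - n)) / 2)"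
    by (simp add: lessThan_Suc_atMost[symmetric] sum.distrib[symmetric] sym_weight_def n_def[symmetric]
        add_divide_distrib)
  have "k = 2 * n \<or> k = 2 * n + 1" unfolding n_def by presburger
  then show ?thesis
  proof
    assume k: "k = 2 * n"
    have "sym_weight k n = 1" by (simp add: sym_weight_def k)
    then show ?thesis using k eq lhs unfolding n_def[symmetric] by simp
  next
    assume k: "k = 2 * n + 1"
    have "sym_weight k n = 2" by (simp add: sym_weight_def k)
    moreover have "k - n = Suc n" using k by simp
    moreover have "(\<Sum>i<Suc n. f (k - i)) = (\<Sum>i<n. f (k - i)) + f (Suc n)" using k by simp
    ultimately show ?thesis using eq lhs unfolding n_def[symmetric] by simp
  qed
qed

text \<open>The weights add up to \<open>k + 1\<close>, and each of the first \<open>j\<close>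
  indices carries weight 2.\<close>

lemma sum_sym_weight_if:
  assumes "j \<le> k div 2"
  shows "(\<Sum>i\<le>k div 2. sym_weight k i * (if i < j then f i else e)) =
    2 * (\<Sum>i<j. f i) + (real k + 1 - 2 * real j) * e"
proof -
  define n where "n = k div 2"
  have j: "j \<le> n" using assms by (simp add: n_def)
  have "(\<Sum>i\<le>n. sym_weight k i * (if i < j then f i else e)) =
      (\<Sum>i<n. 2 * (if i < j then f i else e)) + (real k + 1 - 2 * real n) * e"
    using j by (simp add: lessThan_Suc_atMost[symmetric] sym_weight_def n_def[symmetric])
  also have "(\<Sum>i<n. 2 * (if i < j then f i else e)) =
      (\<Sum>i<j. 2 * (if i < j then f i else e)) + (\<Sum>i=j..<n. 2 * (if i < j then f i else e))"
    using sum.atLeastLessThan_concat[of 0 j n "\<lambda>i. 2 * (if i < j then f i else e)"] j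
    by (simp only: lessThan_atLeast0)
  also have "\<dots> = 2 * (\<Sum>i<j. f i) + 2 * (real n - real j) * e"
    using j by (simp add: sum_distrib_left of_nat_diff)
  finally show ?thesis by (simp add: n_def algebra_simps)
qed

text \<open>The common size of the remaining \<open>k + 1 - 2 * j\<close> gaps once \<alpha>,
  2\<alpha>, ..., \<open>2 ^ (j - 1) * \<alpha>\<close> have been placed on both sides.\<close>

definition mid_gap :: "nat \<Rightarrow> nat \<Rightarrow> real \<Rightarrow> real" where
  "mid_gap k j \<alpha> = 2 * ((pi - (2 ^ j - 1) * \<alpha>) / (real k + 1 - 2 * real j))"

definition opt_gap :: "nat \<Rightarrow> nat \<Rightarrow> real \<Rightarrow> nat \<Rightarrow> real" where
  "opt_gap k j \<alpha> i = (if i < j then 2 ^ i * \<alpha> else mid_gap k j \<alpha>)"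

section \<open>Thresholds for \<alpha> and the index \<open>j\<close>\<close>

lemma threshold_denominator:
  assumes "j \<le> k div 2"
  shows "1 \<le> real k + 1 - 2 * real j" and "0 < 2 ^ j * (real k - 2 * real j + 3) - 2"
proof -
  have "2 * j \<le> k" using assms by simp
  then have "2 * real j \<le> real k" by (metis of_nat_le_iff of_nat_mult of_nat_numeral)
  then show "1 \<le> real k + 1 - 2 * real j" by simp
  have "1 * 3 \<le> 2 ^ j * (real k - 2 * real j + 3)"
    using \<open>2 * real j \<le> real k\<close> by (intro mult_mono) auto
  then show "0 < 2 ^ j * (real k - 2 * real j + 3) - 2" by simp
qed

lemma threshold_mono:
  assumes "i \<le> j" "j \<le> k div 2"
  shows "2 ^ i * (real k - 2 * real i + 3) \<le> 2 ^ j * (real k - 2 * real j + 3)"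
  using assms
proof (induction j rule: dec_induct)
  case (step j)
  have "2 * Suc j \<le> k" using step by simp
  then have "2 * real (Suc j) \<le> real k" by (metis of_nat_le_iff of_nat_mult of_nat_numeral)
  have "2 ^ i * (real k - 2 * real i + 3) \<le> 2 ^ j * (real k - 2 * real j + 3)"
    using step by simp
  also have "\<dots> \<le> 2 ^ j * (2 * (real k - 2 * real (Suc j) + 3))"
    using \<open>2 * real (Suc j) \<le> real k\<close> by (intro mult_left_mono) auto
  also have "\<dots> = 2 ^ Suc j * (real k - 2 * real (Suc j) + 3)" by simp
  finally show ?case .
qed simp

text \<open>This and the next lemma explain the interval defining \<open>j\<close>: the common gap
  lies between the last doubled gap and the next doubling.\<close>

lemma mid_gap_le_iff:
  assumes "j \<le> k div 2"
  shows "mid_gap k j \<alpha> \<le> 2 ^ j * \<alpha> \<longleftrightarrow> 2 * pi / (2 ^ j * (real k - 2 * real j + 3) - 2) \<le> \<alpha>"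
  using threshold_denominator[OF assms]
  by (simp add: mid_gap_def divide_le_eq algebra_simps)

lemma mid_gap_ge_iff:
  assumes "1 \<le> j" "j \<le> k div 2"
  shows "2 ^ (j - 1) * \<alpha> < mid_gap k j \<alpha> \<longleftrightarrow>
    \<alpha> < 2 * pi / (2 ^ (j - 1) * (real k - 2 * (real j - 1) + 3) - 2)"
proof -
  obtain i where i: "j = Suc i" using assms by (cases j) auto
  then have il: "i \<le> k div 2" using assms by simp
  have "(0::real) < 2 ^ (j - 1) * (real k - 2 * (real j - 1) + 3) - 2"
    using threshold_denominator(2)[OF il] i by simp
  then show ?thesis using threshold_denominator(1)[OF assms(2)]
    by (simp add: mid_gap_def less_divide_eq i algebra_simps)
qed

lemma M_up_pos: "0 < M_up k"
  by (simp add: M_up_def)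

lemma m_low_eq:
  assumes "2 \<le> k"
  shows "m_low k = 2 * pi / (2 ^ (k div 2) * (real k - 2 * real (k div 2) + 3) - 2)"
proof -
  obtain n where n: "k div 2 = Suc n" using assms by (cases "k div 2") auto
  have "2 ^ Suc n * c - 2 = 2 * (2 ^ n * c - 1)" for c :: real by (simp add: algebra_simps)
  then show ?thesis
    unfolding m_low_def n diff_Suc_1 by (simp only: mult_divide_mult_cancel_left_if) simp
qed

lemma m_low_pos: "2 \<le> k \<Longrightarrow> 0 < m_low k"
  using threshold_denominator(2)[of "k div 2" k] by (simp add: m_low_eq)

lemma m_low_le_M_up: "2 \<le> k \<Longrightarrow> m_low k \<le> M_up k"
  using threshold_mono[of 0 "k div 2" k] by (simp add: m_low_eq M_up_def frac_le)

text \<open>At the upper end all gaps coincide: the configuration is the regular polygon with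
  \<open>k + 1\<close> vertices.\<close>

lemma mid_gap_M_up:
  assumes "2 \<le> k"
  shows "mid_gap k 1 (M_up k) = M_up k"
proof -
  have "pi - M_up k = M_up k / 2 * (real k - 1)" by (simp add: M_up_def field_simps)
  moreover have "real k - 1 \<noteq> 0" using assms by auto
  ultimately have half: "(pi - M_up k) / (real k - 1) = M_up k / 2"
    by (metis nonzero_mult_div_cancel_right)
  have "mid_gap k 1 (M_up k) = 2 * ((pi - M_up k) / (real k - 1))" by (simp add: mid_gap_def)
  then show ?thesis unfolding half by simp
qed

text \<open>Everything needed about \<open>j\<close>, free of the definite description. The lower
  bound on \<open>mid_gap\<close> is not strict because equality holds at
  \<open>M_up k\<close>.\<close>

lemma j_index_spec:
  assumes k: "2 \<le> k" and \<alpha>: "m_low k \<le> \<alpha>" "\<alpha> \<le> M_up k"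
  defines "j \<equiv> j_index k \<alpha>"
  shows "1 \<le> j" "j \<le> k div 2" "2 ^ (j - 1) * \<alpha> \<le> mid_gap k j \<alpha>" "mid_gap k j \<alpha> \<le> 2 ^ j * \<alpha>"
proof -
  have "1 \<le> j \<and> j \<le> k div 2 \<and> 2 ^ (j - 1) * \<alpha> \<le> mid_gap k j \<alpha> \<and> mid_gap k j \<alpha> \<le> 2 ^ j * \<alpha>"
  proof (cases "\<alpha> = M_up k")
    case True
    then have j: "j = 1" by (simp add: j_def j_index_def)
    have "1 \<le> k div 2" using k by simp
    moreover have "mid_gap k 1 \<alpha> = \<alpha>" using mid_gap_M_up[OF k] True by simp
    ultimately show ?thesis using M_up_pos[of k] True by (simp add: j)
  next
    case False
    let ?D = "\<lambda>j. 2 * pi / (2 ^ j * (real k - 2 * real j + 3) - 2)"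
    let ?P = "\<lambda>j. j \<in> {1..k div 2} \<and> ?D j \<le> \<alpha> \<and>
       \<alpha> < 2 * pi / (2 ^ (j - 1) * (real k - 2 * (real j - 1) + 3) - 2)"
    have ex: "?D (k div 2) \<le> \<alpha>" using \<alpha> k by (simp add: m_low_eq)
    define i where "i = (LEAST j. ?D j \<le> \<alpha>)"
    have Di: "?D i \<le> \<alpha>" unfolding i_def using ex by (rule LeastI)
    have in2: "i \<le> k div 2" unfolding i_def using ex by (rule Least_le)
    \<comment> \<open>The threshold for index 0 is \<open>M_up k\<close> itself, which exceeds
      \<alpha> in this case.\<close>
    have "i \<noteq> 0" using Di False \<alpha> by (intro notI) (simp add: M_up_def add.commute)
    then obtain i' where i': "i = Suc i'" by (cases i) auto
    have "\<not> ?D i' \<le> \<alpha>" using not_less_Least[of i' "\<lambda>j. ?D j \<le> \<alpha>"] i' unfolding i_def by auto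
    then have Pi: "?P i" using Di in2 i' by simp
    \<comment> \<open>Thresholds decrease in the index, so the half-open intervals of different
      indices are disjoint.\<close>
    have uniq: "\<not> (?P a \<and> ?P b)" if ab: "a < b" for a b
    proof
      assume P: "?P a \<and> ?P b"
      obtain b' where b': "b = Suc b'" using ab by (cases b) auto
      have "2 ^ a * (real k - 2 * real a + 3) \<le> 2 ^ b' * (real k - 2 * real b' + 3)"
        using ab P b' by (intro threshold_mono) auto
      then have "?D b' \<le> ?D a"
        using P threshold_denominator(2)[of a k] by (intro frac_le) auto
      then show False using P b' by auto
    qed
    have "?P (THE j. ?P j)"
    proof (rule theI[of ?P i])
      show "x = i" if "?P x" for x
        using uniq[of x i] uniq[of i x] that Pi by (cases x i rule: linorder_cases) blast+
    qed (rule Pi)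
    moreover have "j = (THE j. ?P j)" using False by (simp add: j_def j_index_def)
    ultimately have "?P j" by simp
    then show ?thesis using mid_gap_le_iff[of j k \<alpha>] mid_gap_ge_iff[of j k \<alpha>] by auto
  qed
  then show "1 \<le> j" "j \<le> k div 2" "2 ^ (j - 1) * \<alpha> \<le> mid_gap k j \<alpha>" "mid_gap k j \<alpha> \<le> 2 ^ j * \<alpha>" by auto
qed

text \<open>Identifies \<open>s_fun\<close> as the perimeter of the extremal polygon without one
  edge over the arc \<alpha>.\<close>

lemma s_fun_eq:
  assumes "2 \<le> k" "m_low k \<le> \<alpha>" "\<alpha> \<le> M_up k"
  defines "j \<equiv> j_index k \<alpha>"
  shows "s_fun k \<alpha> = (\<Sum>i\<le>k div 2. sym_weight k i * chord (opt_gap k j \<alpha> i)) - chord \<alpha>"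
proof -
  have j: "j \<le> k div 2" unfolding j_def using assms by (intro j_index_spec)
  have "(\<Sum>i\<le>k div 2. sym_weight k i * chord (opt_gap k j \<alpha> i)) =
    2 * (\<Sum>i<j. chord (2 ^ i * \<alpha>)) + (real k + 1 - 2 * real j) * chord (mid_gap k j \<alpha>)"
    unfolding opt_gap_def if_distrib[of chord] by (rule sum_sym_weight_if[OF j])
  \<comment> \<open>With \<open>l = i + 1\<close>, the factor 2 to the power \<open>l - 2\<close> is
    half of \<open>2 ^ i\<close>; the exponent is -1 for \<open>l = 1\<close>, hence
    \<open>powi\<close>.\<close>
  moreover have "4 * (\<Sum>l = 1..j. sin (2 powi (int l - 2) * \<alpha>)) = 2 * (\<Sum>i<j. chord (2 ^ i * \<alpha>))"
  proof -
    have "(\<Sum>l = 1..j. sin (2 powi (int l - 2) * \<alpha>)) = (\<Sum>i<j. sin (2 powi (int (Suc i) - 2) * \<alpha>))"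
      by (rule sum.reindex_bij_witness[where i = Suc and j = "\<lambda>l. l - 1"]) auto
    also have "\<dots> = (\<Sum>i<j. sin (2 ^ i * \<alpha> / 2))"
    proof (rule sum.cong)
      fix i
      have "(2::real) powi (int (Suc i) - 2) = 2 powi (int i - 1)" by simp
      also have "\<dots> = 2 ^ i / 2" by (simp add: power_int_diff)
      finally have "(2::real) powi (int (Suc i) - 2) * \<alpha> = 2 ^ i * \<alpha> / 2" by (simp only: times_divide_eq_left)
      then show "sin (2 powi (int (Suc i) - 2) * \<alpha>) = sin (2 ^ i * \<alpha> / 2)" by (simp only:)
    qed simp
    finally show ?thesis by (simp add: chord_def sum_distrib_left)
  qed
  moreover have "mid_gap k j \<alpha> / 2 = (pi - (2 ^ j - 1) * \<alpha>) / (real k + 1 - 2 * real j)"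
    unfolding mid_gap_def by (rule nonzero_mult_div_cancel_left) simp
  ultimately show ?thesis
    unfolding s_fun_def Let_def j_def[symmetric] by (simp add: chord_def algebra_simps)
qed

lemma sum_doubling: "(\<Sum>i<j. 2 ^ i * \<alpha>) = (2 ^ j - 1) * (\<alpha>::real)"
  by (simp add: sum_distrib_right[symmetric] sum_gp_strict)

lemma opt_gap_total:
  assumes "j \<le> k div 2"
  shows "(\<Sum>i\<le>k div 2. sym_weight k i * opt_gap k j \<alpha> i) = 2 * pi"
proof -
  have "(real k + 1 - 2 * real j) * mid_gap k j \<alpha> = 2 * (pi - (2 ^ j - 1) * \<alpha>)"
    using threshold_denominator(1)[OF assms] by (simp add: mid_gap_def)
  then show ?thesis unfolding opt_gap_def sum_sym_weight_if[OF assms] sum_doubling by simp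
qed

text \<open>Mirroring \<open>opt_gap\<close> gives gaps to which \<open>min_path_ge_of_gaps\<close>
  applies: a doubled gap equals \<alpha> plus all earlier ones, and \<open>mid_gap\<close> is at
  most the next doubling.\<close>

lemma exists_config_ge_s_fun:
  assumes k: "2 \<le> k" and \<alpha>: "m_low k \<le> \<alpha>" "\<alpha> \<le> M_up k"
  shows "\<exists>T \<in> {1..k} \<rightarrow>\<^sub>E unit_circle. s_fun k \<alpha> \<le> min_path k T"
proof -
  define j where "j = j_index k \<alpha>"
  have j: "1 \<le> j" "j \<le> k div 2" "2 ^ (j - 1) * \<alpha> \<le> mid_gap k j \<alpha>" "mid_gap k j \<alpha> \<le> 2 ^ j * \<alpha>"
    unfolding j_def using assms by (intro j_index_spec; simp)+
  have pos: "0 < \<alpha>" using m_low_pos[OF k] \<alpha> by simp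
  define g where "g i = opt_gap k j \<alpha> (min i (k - i))" for i
  have sym: "g (k - i) = g i" if "i \<le> k" for i using that by (simp add: g_def min.commute)
  have g_sum: "(\<Sum>i\<le>k. f (g i)) = (\<Sum>i\<le>k div 2. sym_weight k i * f (opt_gap k j \<alpha> i))" for f :: "real \<Rightarrow> real"
  proof (rule trans[OF sum_eq_sym_weight], rule sum.cong)
    fix i assume "i \<in> {..k div 2}"
    then have "i \<le> k - i" "i \<le> k" by auto
    then have "g i = opt_gap k j \<alpha> i" "g (k - i) = opt_gap k j \<alpha> i" using sym[of i] by (auto simp: g_def)
    then show "sym_weight k i * ((f (g i) + f (g (k - i))) / 2) = sym_weight k i * f (opt_gap k j \<alpha> i)" by simp
  qed simp
  have beta: "0 < mid_gap k j \<alpha>" using j(3) pos by (smt (verit) mult_pos_pos zero_less_power)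
  have gpos: "0 < g i" for i using pos beta by (simp add: g_def opt_gap_def)
  have gk: "g k = \<alpha>" "g 0 = \<alpha>" using j by (simp_all add: g_def opt_gap_def)
  have low: "g l = 2 ^ l * \<alpha>" if "l < j" for l
    using that j by (simp add: g_def opt_gap_def min_def)
  have right: "g i \<le> \<alpha> + (\<Sum>l<i. g l)" for i
  proof -
    have "g i \<le> 2 ^ min i j * \<alpha>"
    proof (cases "i < j")
      case False
      have "(2::real) ^ min i (k - i) \<le> 2 ^ j" if "min i (k - i) < j" using that by (intro power_increasing) auto
      then show ?thesis using False j(4) pos by (auto simp: g_def opt_gap_def min_def)
    qed (simp add: low)
    also have "\<dots> = \<alpha> + (\<Sum>l<min i j. 2 ^ l * \<alpha>)"
      unfolding sum_doubling by (simp add: left_diff_distrib)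
    also have "(\<Sum>l<min i j. 2 ^ l * \<alpha>) = (\<Sum>l<min i j. g l)" by (simp add: low)
    also have "(\<Sum>l<min i j. g l) \<le> (\<Sum>l<i. g l)" using gpos by (intro sum_mono2) (auto intro: less_imp_le)
    finally show ?thesis by simp
  qed
  have left: "g i \<le> g 0 + (\<Sum>l=Suc i..k. g l)" if "i \<le> k" for i
  proof -
    have "(\<Sum>l=Suc i..k. g l) = (\<Sum>l<k - i. g l)"
      by (rule sum.reindex_bij_witness[where i = "\<lambda>l. k - l" and j = "\<lambda>l. k - l"]) (auto simp: sym)
    then show ?thesis using right[of "k - i"] sym[OF that] gk by simp
  qed
  define T where "T = restrict (\<lambda>i. circle_point (\<Sum>l<i. g l)) {1..k}"
  have "(\<Sum>i<k. chord (g i)) \<le> min_path k T"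
  proof (rule min_path_ge_of_gaps)
    show "(\<Sum>i\<le>k. g i) = 2 * pi" using g_sum[of "\<lambda>x. x"] opt_gap_total[OF j(2)] by simp
  qed (use k gpos right left gk in \<open>auto simp: T_def\<close>)
  moreover have "(\<Sum>i<k. chord (g i)) = s_fun k \<alpha>"
    using g_sum[of chord] s_fun_eq[OF assms] gk by (simp add: j_def lessThan_Suc_atMost[symmetric])
  ultimately show ?thesis by (intro bexI[of _ T]) (auto simp: T_def circle_point_in_circle)
qed

subsection \<open>Paths with one jump\<close>

text \<open>Concavity on the interval from 0 to \<open>2 * pi\<close>, as a tangent bound: the slope
  \<open>cos (w / 2)\<close> decreases there.\<close>

lemma chord_cos_bound:
  assumes "0 \<le> w" "w \<le> 2 * pi" "0 \<le> z" "z \<le> 2 * pi"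
  shows "chord z \<le> chord w + cos (w / 2) * (z - w)"
proof -
  have der: "DERIV chord x :> cos (x / 2)" for x
    unfolding chord_def by (auto intro!: derivative_eq_intros)
  consider "w = z" | "w < z" | "z < w" by linarith
  then show ?thesis
  proof cases
    case 2
    then obtain x where x: "w < x" "x < z" "chord z - chord w = (z - w) * cos (x / 2)"
      using MVT2[of w z chord "\<lambda>x. cos (x / 2)"] der by blast
    have "cos (x / 2) \<le> cos (w / 2)" using x assms by (intro cos_monotone_0_pi_le) auto
    then have "(z - w) * cos (x / 2) \<le> (z - w) * cos (w / 2)" using 2 by (intro mult_left_mono) auto
    then have "chord z - chord w \<le> cos (w / 2) * (z - w)" unfolding x(3) by (simp only: mult.commute)
    then show ?thesis by simp
  next
    case 3
    then obtain x where x: "z < x" "x < w" "chord w - chord z = (w - z) * cos (x / 2)"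
      using MVT2[of z w chord "\<lambda>x. cos (x / 2)"] der by blast
    have "cos (w / 2) \<le> cos (x / 2)" using x assms by (intro cos_monotone_0_pi_le) auto
    then have "(w - z) * cos (w / 2) \<le> (w - z) * cos (x / 2)" using 3 by (intro mult_left_mono) auto
    then show ?thesis using x by (simp add: algebra_simps)
  qed simp
qed

lemma chord_midpoint:
  assumes "0 \<le> x" "x \<le> 2 * pi" "0 \<le> y" "y \<le> 2 * pi"
  shows "(chord x + chord y) / 2 \<le> chord ((x + y) / 2)"
proof -
  let ?m = "(x + y) / 2"
  have "cos (?m / 2) * (x - ?m) + cos (?m / 2) * (y - ?m) = 0"
    unfolding distrib_left[symmetric] by (simp add: field_simps)
  then show ?thesis using chord_cos_bound[of ?m x] chord_cos_bound[of ?m y] assms by simp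
qed

text \<open>The path follows \<open>p\<close> up to position \<open>b\<close>, jumps to position
  \<open>k\<close> and descends to \<open>Suc b\<close>. It omits the gaps \<open>k\<close> and
  \<open>b\<close>; the jump is measured along the complementary arc over the base point. A general
  \<open>p\<close> allows both orientations.\<close>

lemma min_path_le_one_jump:
  fixes g :: "nat \<Rightarrow> real"
  assumes tot: "(\<Sum>i\<le>k. g i) = 2 * pi" and p: "p permutes {1..k}" and b: "b < k"
    and d: "\<And>i j. i \<le> j \<Longrightarrow> j \<le> k \<Longrightarrow>
      dist ((T(0 := base_point)) (p i)) ((T(0 := base_point)) (p j)) = chord (\<Sum>l=i..<j. g l)"
  shows "min_path k T \<le> (\<Sum>i\<le>k. chord (g i)) - chord (g k) - chord (g b) + chord (g k + (\<Sum>i<b. g i))"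
proof -
  define r where "r = (\<lambda>l. if Suc b \<le> l \<and> l \<le> k then Suc (b + k) - l else l)"
  define e where "e i j = dist ((T(0 := base_point)) (p i)) ((T(0 := base_point)) (p j))" for i j
  have e_sym: "e i j = e j i" for i j unfolding e_def by (rule dist_commute)
  have e_gap: "e i (Suc i) = chord (g i)" if "i < k" for i
    using d[of i "Suc i"] that unfolding e_def by simp
  have r: "r permutes {1..k}" unfolding r_def using reversal_permutes[of b k k] b by simp
  have "(\<Sum>i<k. e (r i) (r (Suc i))) = (\<Sum>i<b. e (r i) (r (Suc i))) + e (r b) (r (Suc b))
      + (\<Sum>i=Suc b..<k. e (r i) (r (Suc i)))"
    using sum.atLeastLessThan_concat[of 0 b k "\<lambda>i. e (r i) (r (Suc i))"]
      sum.atLeast_Suc_lessThan[of b k "\<lambda>i. e (r i) (r (Suc i))"] b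
    by (simp add: lessThan_atLeast0)
  also have "(\<Sum>i<b. e (r i) (r (Suc i))) = (\<Sum>i<b. chord (g i))"
    using b by (intro sum.cong) (auto simp: r_def e_gap)
  also have "(\<Sum>i=Suc b..<k. e (r i) (r (Suc i))) = (\<Sum>i=Suc b..<k. chord (g i))"
  proof (rule sum.reindex_bij_witness[where i = "\<lambda>i. b + k - i" and j = "\<lambda>i. b + k - i"])
    fix i assume i: "i \<in> {Suc b..<k}"
    then have "r i = Suc (b + k - i)" "r (Suc i) = b + k - i" "b + k - i < k" by (auto simp: r_def)
    then show "chord (g (b + k - i)) = e (r i) (r (Suc i))"
      using e_gap[of "b + k - i"] e_sym by simp
  qed auto
  also have "e (r b) (r (Suc b)) = chord (g k + (\<Sum>i<b. g i))"
  proof -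
    have "e (r b) (r (Suc b)) = chord (\<Sum>l=b..<k. g l)" using d[of b k] b by (simp add: r_def e_def)
    also have "(\<Sum>l=b..<k. g l) = 2 * pi - (g k + (\<Sum>i<b. g i))"
      using sum.atLeastLessThan_concat[of 0 b k g] b tot
      by (simp add: lessThan_atLeast0 lessThan_Suc_atMost[symmetric])
    finally show ?thesis by (simp only: chord_reflect)
  qed
  also have "(\<Sum>i<b. chord (g i)) + chord (g k + (\<Sum>i<b. g i)) + (\<Sum>i=Suc b..<k. chord (g i)) =
     (\<Sum>i\<le>k. chord (g i)) - chord (g k) - chord (g b) + chord (g k + (\<Sum>i<b. g i))"
    using sum.atLeastLessThan_concat[of 0 b k "\<lambda>i. chord (g i)"]
      sum.atLeast_Suc_lessThan[of b k "\<lambda>i. chord (g i)"] b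
    by (simp add: lessThan_atLeast0 lessThan_Suc_atMost[symmetric])
  finally have "(\<Sum>i<k. e (r i) (r (Suc i))) =
     (\<Sum>i\<le>k. chord (g i)) - chord (g k) - chord (g b) + chord (g k + (\<Sum>i<b. g i))" .
  moreover have "path_length k T (p \<circ> r) = (\<Sum>i<k. e (r i) (r (Suc i)))"
    using permutes_compose[OF r p] b by (simp add: path_length_route_len route_len_def e_def o_def)
  ultimately show ?thesis using min_path_le[OF permutes_compose[OF r p], of T] by simp
qed

lemma sorting_permutation:
  fixes t :: "nat \<Rightarrow> real"
  obtains p where "p permutes {1..k}" "\<And>i j. 1 \<le> i \<Longrightarrow> i \<le> j \<Longrightarrow> j \<le> k \<Longrightarrow> t (p i) \<le> t (p j)"
proof -
  define xs where "xs = sort_key t [1..<Suc k]"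
  have xs: "length xs = k" "set xs = {1..k}" "distinct xs" "sorted (map t xs)"
    by (auto simp: xs_def)
  define p where "p i = (if i \<in> {1..k} then xs ! (i - 1) else i)" for i
  have "bij_betw (\<lambda>i. xs ! (i - 1)) {1..k} {1..k}"
  proof (rule bij_betw_trans[of "\<lambda>i. i - 1" _ "{..<k}" "(!) xs", unfolded o_def])
    show "bij_betw (\<lambda>i. i - 1) {1..k} {..<k}"
      by (rule bij_betw_byWitness[where f' = Suc]) auto
    show "bij_betw ((!) xs) {..<k} {1..k}"
      using bij_betw_nth[OF xs(3)] xs by auto
  qed
  then have "bij_betw p {1..k} {1..k}"
    by (rule bij_betw_cong[THEN iffD1, rotated]) (auto simp: p_def)
  then have "p permutes {1..k}"
    by (rule bij_imp_permutes) (auto simp: p_def)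
  moreover have "t (p i) \<le> t (p j)" if "1 \<le> i" "i \<le> j" "j \<le> k" for i j
    using sorted_nth_mono[OF xs(4), of "i - 1" "j - 1"] that xs(1) by (auto simp: p_def)
  ultimately show thesis using that by blast
qed

text \<open>The gaps come from sorting the points by angle. The two families of bounds are the
  one-jump paths in the two orientations.\<close>

lemma min_path_le_gaps:
  assumes T: "T \<in> {1..k} \<rightarrow>\<^sub>E unit_circle" and k: "1 \<le> k"
  obtains g :: "nat \<Rightarrow> real" where "\<And>i. 0 \<le> g i" "(\<Sum>i\<le>k. g i) = 2 * pi"
    "\<And>b. b < k \<Longrightarrow> min_path k T \<le> (\<Sum>i\<le>k. chord (g i)) - chord (g k) - chord (g b) + chord (g k + (\<Sum>i<b. g i))"
    "\<And>b. b < k \<Longrightarrow> min_path k T \<le> (\<Sum>i\<le>k. chord (g i)) - chord (g 0) - chord (g (k - b))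
        + chord (g 0 + (\<Sum>i<b. g (k - i)))"
proof -
  let ?P = "T(0 := base_point)"
  have "\<exists>s. 0 \<le> s \<and> s \<le> 2 * pi \<and> T i = circle_point s" if "i \<in> {1..k}" for i
    using unit_circle_angle[of "T i"] PiE_mem[OF T that] by (metis less_imp_le)
  then obtain t0 where t0: "\<And>i. i \<in> {1..k} \<Longrightarrow> 0 \<le> t0 i \<and> t0 i \<le> 2 * pi \<and> T i = circle_point (t0 i)"
    by metis
  obtain p where p: "p permutes {1..k}" and mono: "\<And>i j. 1 \<le> i \<Longrightarrow> i \<le> j \<Longrightarrow> j \<le> k \<Longrightarrow> t0 (p i) \<le> t0 (p j)"
    using sorting_permutation[of k t0] by blast
  have p0: "p 0 = 0" using p by (rule permutes_not_in) simp
  have p_in: "p i \<in> {1..k}" if "1 \<le> i" "i \<le> k" for i using permutes_in_image[OF p, of i] that by simp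
  \<comment> \<open>The value \<open>2 * pi\<close> beyond \<open>k\<close> makes \<open>g k\<close>
    the closing gap and all later gaps 0.\<close>
  define \<theta> where "\<theta> i = (if i = 0 then 0 else if i \<le> k then t0 (p i) else 2 * pi)" for i
  define g where "g i = \<theta> (Suc i) - \<theta> i" for i
  have P: "?P (p i) = circle_point (\<theta> i)" if "i \<le> k" for i
    using t0[OF p_in[of i]] p_in[of i] that by (auto simp: \<theta>_def p0 circle_point_0)
  have g0: "0 \<le> g i" for i
    using mono[of i "Suc i"] t0[OF p_in[of i]] t0[OF p_in[of "Suc i"]] by (auto simp: g_def \<theta>_def)
  have tele: "(\<Sum>l=i..<j. g l) = \<theta> j - \<theta> i" if "i \<le> j" for i j
    unfolding g_def using that by (rule sum_Suc_diff')
  have tot: "(\<Sum>i\<le>k. g i) = 2 * pi" using tele[of 0 "Suc k"]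
    by (simp add: \<theta>_def lessThan_atLeast0 lessThan_Suc_atMost[symmetric])
  have part: "0 \<le> (\<Sum>l=i..<j. g l) \<and> (\<Sum>l=i..<j. g l) \<le> 2 * pi" if "j \<le> Suc k" for i j
  proof -
    have "(\<Sum>l=i..<j. g l) \<le> (\<Sum>i\<le>k. g i)" using that g0 by (intro sum_mono2) auto
    then show ?thesis using g0 tot by (simp add: sum_nonneg)
  qed
  have d: "dist (?P (p i)) (?P (p j)) = chord (\<Sum>l=i..<j. g l)" if "i \<le> j" "j \<le> k" for i j
  proof -
    have "dist (circle_point (\<theta> i)) (circle_point (\<theta> j)) = chord (\<theta> j - \<theta> i)"
      using part[of j i] that by (intro dist_circle_point_chord) (auto simp: tele)
    then show ?thesis using that by (simp only: tele P)
  qed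
  define r where "r = (\<lambda>l. if Suc 0 \<le> l \<and> l \<le> k then Suc (0 + k) - l else l)"
  have r: "r permutes {1..k}" unfolding r_def using k by (intro reversal_permutes) auto
  have mirror: "(\<Sum>l=i..<j. g (k - l)) = (\<Sum>l=Suc k - j..<Suc k - i. g l)" if "j \<le> Suc k" for i j
    using that by (intro sum.reindex_bij_witness[where i = "\<lambda>l. k - l" and j = "\<lambda>l. k - l"]) auto
  have d': "dist (?P ((p \<circ> r) i)) (?P ((p \<circ> r) j)) = chord (\<Sum>l=i..<j. g (k - l))" if "i \<le> j" "j \<le> k" for i j
  proof -
    \<comment> \<open>The reversal \<open>r\<close> fixes the base point, so arcs starting there
      become complementary arcs, while all others are only mirrored.\<close>
    consider "i = j" | "i = 0" "0 < j" | "0 < i" "i < j" using \<open>i \<le> j\<close> by linarith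
    then show ?thesis
    proof cases
      case 2
      have "dist (?P ((p \<circ> r) i)) (?P ((p \<circ> r) j)) = chord (\<Sum>l=0..<Suc k - j. g l)"
        using d[of 0 "Suc k - j"] 2 that by (simp add: r_def del: fun_upd_apply)
      also have "(\<Sum>l=0..<Suc k - j. g l) = 2 * pi - (\<Sum>l=i..<j. g (k - l))"
        using sum.atLeastLessThan_concat[of 0 "Suc k - j" "Suc k" g] tot mirror[of j i] 2 that
        by (simp add: lessThan_atLeast0 lessThan_Suc_atMost[symmetric])
      finally show ?thesis by (simp only: chord_reflect)
    next
      case 3
      have "dist (?P ((p \<circ> r) i)) (?P ((p \<circ> r) j)) = dist (?P (p (Suc k - j))) (?P (p (Suc k - i)))"
        using 3 that by (simp add: r_def dist_commute del: fun_upd_apply)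
      then show ?thesis using d[of "Suc k - j" "Suc k - i"] mirror[of j i] 3 that
        by (simp del: fun_upd_apply)
    qed (simp add: chord_def)
  qed
  show thesis
  proof (rule that[of g])
    show "min_path k T \<le> (\<Sum>i\<le>k. chord (g i)) - chord (g k) - chord (g b) + chord (g k + (\<Sum>i<b. g i))"
      if "b < k" for b
      by (rule min_path_le_one_jump[OF tot p that d])
    have "(\<Sum>i\<le>k. g (k - i)) = 2 * pi" "(\<Sum>i\<le>k. chord (g (k - i))) = (\<Sum>i\<le>k. chord (g i))"
      using tot sum.atLeastAtMost_rev[of g 0 k] sum.atLeastAtMost_rev[of "\<lambda>i. chord (g i)" 0 k]
      by (simp_all add: atMost_atLeast0)
    then show "min_path k T \<le> (\<Sum>i\<le>k. chord (g i)) - chord (g 0) - chord (g (k - b))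
        + chord (g 0 + (\<Sum>i<b. g (k - i)))" if "b < k" for b
      using min_path_le_one_jump[OF _ permutes_compose[OF r p] that d'] by simp
  qed (use g0 tot in auto)
qed

subsection \<open>Symmetric configurations\<close>

lemma sym_weight_ge_1: "1 \<le> sym_weight k i"
  using sym_weight_cases[of k i] by auto

lemma sym_weight_nonneg: "0 \<le> sym_weight k i"
  using sym_weight_cases[of k i] by auto

lemma sym_weight_0: "2 \<le> k \<Longrightarrow> sym_weight k 0 = 2"
  by (simp add: sym_weight_def)

text \<open>Setting the coordinates beyond \<open>k div 2\<close> to 0 makes the set compact in the
  product topology on functions.\<close>

definition sym_simplex :: "nat \<Rightarrow> (nat \<Rightarrow> real) set" where
  "sym_simplex k = {z. (\<forall>i. 0 \<le> z i) \<and> (\<forall>i > k div 2. z i = 0) \<and>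
     (\<Sum>i\<le>k div 2. sym_weight k i * z i) = 2 * pi}"

text \<open>Length of the path around a symmetric configuration that first takes \<open>b\<close> steps to one side, then
  jumps back over the base point and goes all the way round.\<close>

definition sym_path :: "nat \<Rightarrow> nat \<Rightarrow> (nat \<Rightarrow> real) \<Rightarrow> real" where
  "sym_path k b z = (\<Sum>i\<le>k div 2. sym_weight k i * chord (z i)) - chord (z 0) - chord (z b)
     + chord (z 0 + (\<Sum>i<b. z i))"

lemma weighted_le_2pi:
  assumes "\<And>i. i \<le> k div 2 \<Longrightarrow> 0 \<le> z i" "(\<Sum>i\<le>k div 2. sym_weight k i * z i) = 2 * pi" "i \<le> k div 2"
  shows "z i \<le> 2 * pi"
proof -
  have "1 * z i \<le> sym_weight k i * z i" using sym_weight_ge_1 assms(1)[OF assms(3)] by (rule mult_right_mono)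
  also have "\<dots> \<le> (\<Sum>i\<le>k div 2. sym_weight k i * z i)"
    using assms sym_weight_nonneg by (intro member_le_sum) auto
  finally show ?thesis using assms(2) by simp
qed

text \<open>The second copy of \<open>z 0\<close> is covered by the weight 2 of index 0. Thus the
  jump arc and the gap \<open>b\<close> together fit into the circle, as comparing their chords
  requires.\<close>

lemma simplex_prefix_le:
  assumes k: "2 \<le> k" and z: "z \<in> sym_simplex k" and b: "1 \<le> b" "b \<le> k div 2"
  shows "z 0 + (\<Sum>i<b. z i) + sym_weight k b * z b \<le> 2 * pi"
proof -
  have z0: "0 \<le> z i" for i using z by (simp add: sym_simplex_def)
  define f where "f i = (if i = b then sym_weight k b * z b else z i) + (if i = 0 then z 0 else 0)" for i
  have "(\<Sum>i<b. f i) = (\<Sum>i<b. z i) + z 0"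
    unfolding f_def sum.distrib using b by (simp add: sum.delta)
  then have "z 0 + (\<Sum>i<b. z i) + sym_weight k b * z b = (\<Sum>i\<le>b. f i)"
    using b by (simp add: lessThan_Suc_atMost[symmetric] f_def)
  also have "\<dots> \<le> (\<Sum>i\<le>b. sym_weight k i * z i)"
  proof (rule sum_mono)
    fix i
    show "f i \<le> sym_weight k i * z i"
      using mult_right_mono[OF sym_weight_ge_1[of k i] z0[of i]] b k by (auto simp: f_def sym_weight_0)
  qed
  also have "\<dots> \<le> (\<Sum>i\<le>k div 2. sym_weight k i * z i)"
    using b z0 sym_weight_nonneg by (intro sum_mono2) auto
  finally show ?thesis using z by (simp add: sym_simplex_def)
qed

lemma min_path_le_sym_path:
  assumes k: "2 \<le> k" and T: "T \<in> {1..k} \<rightarrow>\<^sub>E unit_circle"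
  obtains z where "z \<in> sym_simplex k" "\<And>b. b \<le> k div 2 \<Longrightarrow> min_path k T \<le> sym_path k b z"
proof -
  obtain g :: "nat \<Rightarrow> real" where g0: "\<And>i. 0 \<le> g i" and tot: "(\<Sum>i\<le>k. g i) = 2 * pi"
    and R: "\<And>b. b < k \<Longrightarrow> min_path k T \<le> (\<Sum>i\<le>k. chord (g i)) - chord (g k) - chord (g b) + chord (g k + (\<Sum>i<b. g i))"
    and L: "\<And>b. b < k \<Longrightarrow> min_path k T \<le> (\<Sum>i\<le>k. chord (g i)) - chord (g 0) - chord (g (k - b))
        + chord (g 0 + (\<Sum>i<b. g (k - i)))"
    using min_path_le_gaps[OF T] k by auto
  define z where "z i = (if i \<le> k div 2 then (g i + g (k - i)) / 2 else 0)" for i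
  have zS: "z \<in> sym_simplex k"
    using g0 tot by (simp add: sym_simplex_def z_def sum_eq_sym_weight[of g] add_nonneg_nonneg)
  define e where "e i = (chord (g i) + chord (g (k - i))) / 2" for i
  have g2: "g i \<le> 2 * pi" if "i \<le> k" for i
    unfolding tot[symmetric] using that g0 by (intro member_le_sum) auto
  \<comment> \<open>The gain at index \<open>i\<close> from averaging a gap with its mirror image.
    The subtracted chords lose \<open>D 0 + D b\<close>, which the weighted sum regains; for
    \<open>b = 0\<close> this uses the weight 2 of index 0.\<close>
  define D where "D i = chord (z i) - e i" for i
  have D0: "0 \<le> D i" if "i \<le> k div 2" for i
    using chord_midpoint[of "g i" "g (k - i)"] g0 g2[of i] g2[of "k - i"] that
    by (simp add: D_def e_def z_def)
  have "min_path k T \<le> sym_path k b z" if b: "b \<le> k div 2" for b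
  proof -
    have bk: "b < k" using b k by simp
    define A B where "A = g k + (\<Sum>i<b. g i)" and "B = g 0 + (\<Sum>i<b. g (k - i))"
    have "A = sum g (insert k {..<b})" using bk by (simp add: A_def)
    also have "\<dots> \<le> (\<Sum>i\<le>k. g i)" using bk g0 by (intro sum_mono2) auto
    finally have A: "0 \<le> A" "A \<le> 2 * pi" using tot g0 by (auto simp: A_def intro!: add_nonneg_nonneg sum_nonneg)
    have "B = (\<Sum>i\<in>insert k {..<b}. g (k - i))" using bk by (simp add: B_def)
    also have "\<dots> \<le> (\<Sum>i\<le>k. g (k - i))" using bk g0 by (intro sum_mono2) auto
    also have "\<dots> = (\<Sum>i\<le>k. g i)" by (rule sum.reindex_bij_witness[where i = "\<lambda>i. k - i" and j = "\<lambda>i. k - i"]) auto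
    finally have B: "0 \<le> B" "B \<le> 2 * pi" using tot g0 by (auto simp: B_def intro!: add_nonneg_nonneg sum_nonneg)
    have "(\<Sum>i<b. z i) = (\<Sum>i<b. (g i + g (k - i)) / 2)" using b by (intro sum.cong) (auto simp: z_def)
    then have AB: "(A + B) / 2 = z 0 + (\<Sum>i<b. z i)"
      by (simp add: A_def B_def z_def sum_divide_distrib[symmetric] sum.distrib add_divide_distrib)
    then have mid: "(chord A + chord B) / 2 \<le> chord (z 0 + (\<Sum>i<b. z i))"
      using chord_midpoint[of A B] A B unfolding AB by simp
    have "D 0 + D b \<le> (\<Sum>i\<in>{0, b}. sym_weight k i * D i)"
    proof (cases "b = 0")
      case False
      have "1 * D 0 \<le> sym_weight k 0 * D 0" "1 * D b \<le> sym_weight k b * D b"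
        using D0[of 0] D0[OF b] by (intro mult_right_mono sym_weight_ge_1; simp)+
      then show ?thesis using False by simp
    qed (simp add: sym_weight_0[OF k])
    also have "\<dots> \<le> (\<Sum>i\<le>k div 2. sym_weight k i * D i)"
      using b D0 sym_weight_nonneg by (intro sum_mono2) auto
    also have "\<dots> = (\<Sum>i\<le>k div 2. sym_weight k i * chord (z i)) - (\<Sum>i\<le>k. chord (g i))"
      unfolding sum_eq_sym_weight[of "\<lambda>i. chord (g i)" k] by (simp add: D_def e_def right_diff_distrib sum_subtractf)
    finally have "D 0 + D b \<le> \<dots>" .
    moreover have "min_path k T \<le> (\<Sum>i\<le>k. chord (g i)) - e 0 - e b + (chord A + chord B) / 2"
    proof -
      define q where "q = chord (g (k - b))"
      have "min_path k T \<le> (\<Sum>i\<le>k. chord (g i)) - chord (g k) - chord (g b) + chord A"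
        "min_path k T \<le> (\<Sum>i\<le>k. chord (g i)) - chord (g 0) - q + chord B"
        unfolding A_def B_def q_def by (rule R[OF bk], rule L[OF bk])
      moreover have "e 0 = (chord (g 0) + chord (g k)) / 2" "e b = (chord (g b) + q) / 2"
        by (simp_all add: e_def q_def)
      ultimately show ?thesis by argo
    qed
    ultimately show ?thesis using mid unfolding D_def sym_path_def by argo
  qed
  then show thesis using that zS by blast
qed

section \<open>The best symmetric configuration\<close>

lemma compact_sym_simplex: "compact (sym_simplex k)"
proof -
  define K where "K = Pi\<^sub>E UNIV (\<lambda>i. if i \<le> k div 2 then {0..2 * pi} else {0::real})"
  have "compactin (product_topology (\<lambda>i. euclidean) UNIV) K"
    unfolding K_def by (subst compactin_PiE) (auto simp: compactin_euclidean_iff)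
  then have "compact K" by (simp add: euclidean_product_topology compactin_euclidean_iff)
  moreover have "closed {z :: nat \<Rightarrow> real. (\<Sum>i\<le>k div 2. sym_weight k i * z i) = 2 * pi}"
    by (intro closed_Collect_eq continuous_intros) auto
  moreover have "sym_simplex k = K \<inter> {z. (\<Sum>i\<le>k div 2. sym_weight k i * z i) = 2 * pi}"
  proof (intro subset_antisym subsetI)
    fix z assume "z \<in> sym_simplex k"
    then show "z \<in> K \<inter> {z. (\<Sum>i\<le>k div 2. sym_weight k i * z i) = 2 * pi}"
      using weighted_le_2pi[of k z] by (auto simp: sym_simplex_def K_def)
  next
    fix z assume z: "z \<in> K \<inter> {z. (\<Sum>i\<le>k div 2. sym_weight k i * z i) = 2 * pi}"
    then have "z i \<in> (if i \<le> k div 2 then {0..2 * pi} else {0})" for i by (auto simp: K_def PiE_iff)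
    then have "0 \<le> z i \<and> (k div 2 < i \<longrightarrow> z i = 0)" for i by (metis atLeastAtMost_iff leD order_refl singletonD)
    then show "z \<in> sym_simplex k" using z by (auto simp: sym_simplex_def)
  qed
  ultimately show ?thesis by (simp add: compact_Int_closed)
qed

lemma continuous_on_sym_path: "continuous_on UNIV (sym_path k b)"
  unfolding sym_path_def[abs_def] chord_def by (intro continuous_intros) auto

lemma continuous_on_Min_sym_path: "continuous_on UNIV (\<lambda>z. Min ((\<lambda>b. sym_path k b z) ` {..m}))"
proof (induction m)
  case (Suc m)
  have "Min ((\<lambda>b. sym_path k b z) ` {..Suc m}) =
      min (sym_path k (Suc m) z) (Min ((\<lambda>b. sym_path k b z) ` {..m}))" for z
    by (simp add: atMost_Suc)
  then show ?case using Suc continuous_on_sym_path by (simp add: continuous_on_min)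
qed (simp add: continuous_on_sym_path)

lemma DERIV_chord:
  "(f has_real_derivative f') (at x) \<Longrightarrow> ((\<lambda>x. chord (f x)) has_real_derivative cos (f x / 2) * f') (at x)"
  unfolding chord_def by (auto intro!: derivative_eq_intros)

lemma DERIV_sym_path:
  "((\<lambda>h. sym_path k b (\<lambda>i. z i + h * u i)) has_real_derivative
     (\<Sum>i\<le>k div 2. sym_weight k i * (cos (z i / 2) * u i)) - cos (z 0 / 2) * u 0 - cos (z b / 2) * u b
     + cos ((z 0 + (\<Sum>i<b. z i)) / 2) * (u 0 + (\<Sum>i<b. u i))) (at 0)"
proof -
  have lin: "((\<lambda>h. z i + h * u i) has_real_derivative u i) (at 0)" for i
    by (auto intro!: derivative_eq_intros)
  have c: "((\<lambda>h. chord (z i + h * u i)) has_real_derivative cos (z i / 2) * u i) (at 0)" for i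
    using DERIV_chord[OF lin] by simp
  have s: "((\<lambda>h. chord (z 0 + h * u 0 + (\<Sum>i<b. z i + h * u i))) has_real_derivative
     cos ((z 0 + (\<Sum>i<b. z i)) / 2) * (u 0 + (\<Sum>i<b. u i))) (at 0)"
    using DERIV_chord[OF DERIV_add[OF lin[of 0] DERIV_sum[of "{..<b}", OF lin]]] by simp
  show ?thesis unfolding sym_path_def
    by (intro DERIV_add DERIV_diff DERIV_sum DERIV_cmult c s)
qed


lemma sym_path_maximiser:
  assumes k: "2 \<le> k"
  obtains z where "z \<in> sym_simplex k" "\<And>b. b \<le> k div 2 \<Longrightarrow> z b \<le> z 0 + (\<Sum>i<b. z i)"
    "\<And>z'. z' \<in> sym_simplex k \<Longrightarrow> \<exists>b\<le>k div 2. sym_path k b z' \<le> sym_path k 0 z"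
proof -
  define n where "n = k div 2"
  have n1: "1 \<le> n" using k by (simp add: n_def)
  define F where "F = sym_path k"
  define G where "G z = Min ((\<lambda>b. F b z) ` {..n})" for z
  have G_le: "G z \<le> F b z" if "b \<le> n" for b z unfolding G_def using that by (intro Min_le) auto
  have G_att: "\<exists>b\<le>n. F b z = G z" for z
  proof -
    have "G z \<in> (\<lambda>b. F b z) ` {..n}" unfolding G_def by (intro Min_in) auto
    then show ?thesis by auto
  qed
  have "(\<lambda>i. if i = 0 then pi else 0) \<in> sym_simplex k"
    using k by (simp add: sym_simplex_def if_distrib[of "\<lambda>x. _ * x"] sym_weight_0 cong: if_cong)
  then have "sym_simplex k \<noteq> {}" by blast
  moreover have "continuous_on (sym_simplex k) G"
    unfolding G_def F_def by (rule continuous_on_subset[OF continuous_on_Min_sym_path]) simp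
  ultimately obtain z where z: "z \<in> sym_simplex k" and max: "\<And>z'. z' \<in> sym_simplex k \<Longrightarrow> G z' \<le> G z"
    using continuous_attains_sup[OF compact_sym_simplex] by metis
  have z0: "0 \<le> z i" for i using z by (simp add: sym_simplex_def)
  define y where "y b = z 0 + (\<Sum>i<b. z i)" for b
  have y_mono: "y a \<le> y b" if "a \<le> b" for a b
    unfolding y_def using that z0 by (auto intro!: sum_mono2)
  have y_ge: "z 0 \<le> y b" for b using y_mono[of 0 b] by (simp add: y_def)
  \<comment> \<open>Path \<open>b\<close> trades the gap \<open>b\<close> for a jump over the arc
    \<open>y b\<close>, relative to path 0.\<close>
  have F0: "F b z - F 0 z = chord (y b) - chord (z b)" for b by (simp add: F_def sym_path_def y_def)
  have prefix: "y b + sym_weight k b * z b \<le> 2 * pi" if "1 \<le> b" "b \<le> n" for b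
    using simplex_prefix_le[OF k z that(1)] that by (simp add: y_def n_def)
  have prefix': "y b + z b \<le> 2 * pi" if "1 \<le> b" "b \<le> n" for b
    using prefix[OF that] mult_right_mono[OF sym_weight_ge_1[of k b] z0[of b]] by simp
  have "z b \<le> y b" if b: "b \<le> n" for b
  proof (rule ccontr)
    assume "\<not> z b \<le> y b"
    then have viol: "y b < z b" by simp
    have b1: "1 \<le> b" using viol by (cases b) (auto simp: y_def)
    \<comment> \<open>Moving mass from the gap \<open>c\<close> (the last one among the shortest paths) to the gap at the base
      point lengthens all shortest paths, contradicting maximality.\<close>
    obtain c where c: "1 \<le> c" "c \<le> n" "y c < z c" and last: "\<And>a. a \<le> n \<Longrightarrow> F a z = G z \<Longrightarrow> a \<le> c"
      and c0: "F 0 z = G z \<Longrightarrow> cos (z c / 2) \<le> 0"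
    proof (cases "F 0 z = G z")
      \<comment> \<open>If path 0 is among the shortest, \<open>chord (z b)\<close> is at most
        \<open>chord (y b)\<close> although \<open>z b\<close> is larger. So the two arcs fill the
        circle and \<open>b\<close> has weight 1: it is the middle gap for even \<open>k\<close>,
        hence the last index.\<close>
      case True
      have "chord (z b) \<le> chord (y b)" using F0[of b] G_le[OF b, of z] True by simp
      then have "2 * pi \<le> y b + z b"
        using chord_strict_mono[of "y b" "z b"] viol order_trans[OF z0 y_ge] by force
      then have eq: "y b + z b = 2 * pi" using prefix'[OF b1 b] by simp
      then have big: "pi < z b" using viol by simp
      have "sym_weight k b * z b \<le> 1 * z b" using prefix[OF b1 b] eq by simp
      then have "sym_weight k b \<noteq> 2" using big pi_gt_zero by auto
      then have "b = n" using b by (auto simp: sym_weight_def n_def split: if_splits)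
      moreover have "cos (z b / 2) \<le> cos (pi / 2)"
        using big eq order_trans[OF z0 y_ge, of b] by (intro cos_monotone_0_pi_le) auto
      ultimately show thesis using that[of b] b1 b viol by auto
    next
      case False
      let ?A = "{a. a \<le> n \<and> F a z = G z}"
      define c where "c = Max ?A"
      have fin: "finite ?A" by (rule finite_subset[of _ "{..n}"]) auto
      have "c \<in> ?A" unfolding c_def using fin G_att[of z] by (intro Max_in) auto
      then have c: "c \<le> n" "F c z = G z" by auto
      have c1: "1 \<le> c" using c False by (cases c) auto
      have "chord (y c) < chord (z c)" using F0[of c] c(2) False G_le[of 0 z] by simp
      then have "y c < z c"
        using chord_mono[of "z c" "y c"] z0[of c] prefix'[OF c1 c(1)] by force
      moreover have "a \<le> c" if "a \<le> n" "F a z = G z" for a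
        unfolding c_def using that fin by (intro Max_ge) auto
      ultimately show thesis using that[of c] c1 c False by auto
    qed
    have yc: "y c < pi" using prefix'[OF c(1,2)] c(3) by simp
    have zc: "z c \<le> 2 * pi" using prefix'[OF c(1,2)] order_trans[OF z0 y_ge, of c] by simp
    define w where "w = sym_weight k c"
    have w: "w = 1 \<or> w = 2" unfolding w_def by (rule sym_weight_cases)
    \<comment> \<open>Raising \<open>z 0\<close> by 1 adds 2 to the total because of its weight;
      \<open>2 / w\<close> taken from gap \<open>c\<close> compensates.\<close>
    define u :: "nat \<Rightarrow> real" where "u i = (if i = 0 then 1 else if i = c then - 2 / w else 0)" for i
    have u_sum: "(\<Sum>i\<le>n. sym_weight k i * (f i * u i)) = 2 * f 0 - 2 * f c" for f :: "nat \<Rightarrow> real"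
    proof -
      have "(\<Sum>i\<le>n. sym_weight k i * (f i * u i)) = (\<Sum>i\<in>{0, c}. sym_weight k i * (f i * u i))"
        using c by (intro sum.mono_neutral_right) (auto simp: u_def)
      also have "\<dots> = 2 * f 0 - 2 * f c"
        using c w sym_weight_0[OF k] by (auto simp: u_def w_def[symmetric])
      finally show ?thesis .
    qed
    have u_prefix: "(\<Sum>i<a. u i) = 1" if "1 \<le> a" "a \<le> c" for a
    proof -
      have "(\<Sum>i<a. u i) = (\<Sum>i\<in>{0}. u i)" using that by (intro sum.mono_neutral_right) (auto simp: u_def)
      then show ?thesis by (simp add: u_def)
    qed
    define Z where "Z h i = z i + h * u i" for h i
    define D where "D a = (\<Sum>i\<le>n. sym_weight k i * (cos (z i / 2) * u i)) - cos (z 0 / 2) * u 0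
        - cos (z a / 2) * u a + cos (y a / 2) * (u 0 + (\<Sum>i<a. u i))" for a
    have der: "((\<lambda>h. F a (Z h)) has_real_derivative D a) (at 0)" for a
      unfolding F_def Z_def D_def y_def n_def by (rule DERIV_sym_path)
    have Z0: "Z 0 = z" by (simp add: Z_def fun_eq_iff)
    have c_pos: "0 < cos (x / 2)" if "0 \<le> x" "x \<le> y c" for x
      using that yc by (intro cos_gt_zero_pi) auto
    have c_less: "cos (z c / 2) < cos (x / 2)" if "0 \<le> x" "x \<le> y c" for x
      using that c(3) zc by (intro cos_monotone_0_pi) auto
    \<comment> \<open>As \<open>a \<le> c\<close>, the jump arc never contains the shrinking gap
      \<open>c\<close>. For \<open>a > 0\<close> it grows at rate 2, and the cosines at
      \<open>z 0\<close> and \<open>y a\<close> are positive and exceed the one at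
      \<open>z c\<close>. For \<open>a = 0\<close> the rate is only 1, and \<open>c0\<close> is
      needed.\<close>
    have D_pos: "0 < D a" if a: "a \<le> n" "F a z = G z" for a
    proof -
      have ac: "a \<le> c" using last[OF a] .
      note p0 = c_pos[OF z0[of 0] y_ge[of c]] c_less[OF z0[of 0] y_ge[of c]]
      note pa = c_pos[OF order_trans[OF z0 y_ge[of a]] y_mono[OF ac]]
        c_less[OF order_trans[OF z0 y_ge[of a]] y_mono[OF ac]]
      consider "a = 0" | "1 \<le> a" "a < c" | "a = c" using ac by linarith
      then show ?thesis
      proof cases
        case 1
        then show ?thesis using c0 a p0 by (simp add: D_def u_sum) (simp add: u_def y_def)
      next
        case 2
        then show ?thesis using p0 pa u_prefix[of a] by (simp add: D_def u_sum) (simp add: u_def)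
      next
        case 3
        then show ?thesis using w p0 pa u_prefix[of a] c(1) by (simp add: D_def u_sum) (auto simp: u_def)
      qed
    qed
    \<comment> \<open>Shortest paths grow by the derivative; the others exceed \<open>G z\<close>
      strictly and keep doing so by continuity.\<close>
    have "\<forall>\<^sub>F h in at_right 0. G z < F a (Z h)" if a: "a \<le> n" for a
    proof (cases "F a z = G z")
      case True
      obtain d where "0 < d" "\<And>h. 0 < h \<Longrightarrow> h < d \<Longrightarrow> F a (Z 0) < F a (Z (0 + h))"
        using DERIV_pos_inc_right[OF der D_pos[OF a True]] by blast
      then show ?thesis using True Z0 by (auto simp: eventually_at_right)
    next
      case False
      then have "G z < F a (Z 0)" using G_le[OF a, of z] Z0 by simp
      moreover have "((\<lambda>h. F a (Z h)) \<longlongrightarrow> F a (Z 0)) (at_right 0)"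
        using DERIV_isCont[OF der[of a]] unfolding isCont_def by (rule filterlim_at_split[THEN iffD1, THEN conjunct2])
      ultimately show ?thesis by (simp add: order_tendstoD)
    qed
    then have "\<forall>\<^sub>F h in at_right 0. \<forall>a\<in>{..n}. G z < F a (Z h)" by (intro eventually_ball_finite) auto
    moreover have "\<forall>\<^sub>F h in at_right 0. h \<in> {0<..<z c / 2}"
      using c(3) order_trans[OF z0 y_ge, of c] by (intro eventually_at_right_real) auto
    ultimately have "\<forall>\<^sub>F h in at_right 0. (\<forall>a\<in>{..n}. G z < F a (Z h)) \<and> h \<in> {0<..<z c / 2}"
      by (rule eventually_conj)
    then obtain h where h: "\<And>a. a \<le> n \<Longrightarrow> G z < F a (Z h)" "0 < h" "h < z c / 2"
      using eventually_happens by fastforce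
    have "G z < G (Z h)" unfolding G_def[of "Z h"] using h(1) by (subst Min_gr_iff) auto
    moreover have "Z h \<in> sym_simplex k"
    proof -
      have "0 \<le> Z h i" for i
        using z0[of i] h w by (auto simp: Z_def u_def)
      moreover have "Z h i = 0" if "k div 2 < i" for i
        using z that c by (auto simp: Z_def u_def sym_simplex_def n_def)
      moreover have "(\<Sum>i\<le>n. sym_weight k i * Z h i) = 2 * pi"
      proof -
        have "(\<Sum>i\<le>n. sym_weight k i * Z h i) =
            (\<Sum>i\<le>n. sym_weight k i * z i) + (\<Sum>i\<le>n. sym_weight k i * (h * u i))"
          by (simp add: Z_def distrib_left sum.distrib)
        then show ?thesis using z u_sum[of "\<lambda>_. h"] by (simp add: sym_simplex_def n_def)
      qed
      ultimately show ?thesis by (simp add: sym_simplex_def n_def)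
    qed
    ultimately show False using max[of "Z h"] by simp
  qed
  moreover have "\<exists>b\<le>n. F b z' \<le> F 0 z" if "z' \<in> sym_simplex k" for z'
    using G_att[of z'] max[OF that] G_le[of 0 z] by force
  ultimately show thesis using that[OF z] unfolding y_def n_def F_def by blast
qed

text \<open>A Lagrange multiplier argument: bound each chord by its tangent at \<open>x i\<close>,
  replace the slopes by the common multiplier \<open>m\<close>, and the linear terms cancel since
  both totals are \<open>2 * pi\<close>.\<close>

lemma weighted_chord_le:
  assumes z: "\<And>i. i \<le> k div 2 \<Longrightarrow> 0 \<le> z i" "(\<Sum>i\<le>k div 2. sym_weight k i * z i) = 2 * pi"
    and x: "\<And>i. i \<le> k div 2 \<Longrightarrow> 0 \<le> x i" "(\<Sum>i\<le>k div 2. sym_weight k i * x i) = 2 * pi"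
    and le: "\<And>i. i \<le> k div 2 \<Longrightarrow> cos (x i / 2) * (z i - x i) \<le> m * (z i - x i)"
  shows "(\<Sum>i\<le>k div 2. sym_weight k i * chord (z i)) \<le> (\<Sum>i\<le>k div 2. sym_weight k i * chord (x i))"
proof -
  have "(\<Sum>i\<le>k div 2. sym_weight k i * chord (z i)) \<le>
      (\<Sum>i\<le>k div 2. sym_weight k i * (chord (x i) + m * (z i - x i)))"
  proof (intro sum_mono mult_left_mono sym_weight_nonneg)
    fix i assume "i \<in> {..k div 2}"
    then have i: "i \<le> k div 2" by simp
    have "chord (z i) \<le> chord (x i) + cos (x i / 2) * (z i - x i)"
      using z(1) x(1) weighted_le_2pi[OF z i] weighted_le_2pi[OF x i] i by (intro chord_cos_bound) auto
    then show "chord (z i) \<le> chord (x i) + m * (z i - x i)" using le[OF i] by simp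
  qed
  also have "\<dots> = (\<Sum>i\<le>k div 2. sym_weight k i * chord (x i)) +
      m * ((\<Sum>i\<le>k div 2. sym_weight k i * z i) - (\<Sum>i\<le>k div 2. sym_weight k i * x i))"
    by (simp add: sum_distrib_left sum_subtractf[symmetric] sum.distrib[symmetric] algebra_simps)
  finally show ?thesis using z x by simp
qed

text \<open>The witness is \<open>z 0\<close>, capped at \<open>M_up k\<close>. Given the doubling
  bounds on the gaps, concavity shows that \<open>opt_gap\<close> has the largest weighted sum of
  chords.\<close>

lemma sym_path_le_s_fun:
  assumes k: "2 \<le> k" and z: "z \<in> sym_simplex k"
    and growth: "\<And>b. b \<le> k div 2 \<Longrightarrow> z b \<le> z 0 + (\<Sum>i<b. z i)"
  obtains \<alpha> where "m_low k \<le> \<alpha>" "\<alpha> \<le> M_up k" "sym_path k 0 z \<le> s_fun k \<alpha>"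
proof -
  define n where "n = k div 2"
  define a where "a = z 0"
  have z0: "0 \<le> z i" and tot: "(\<Sum>i\<le>k div 2. sym_weight k i * z i) = 2 * pi" for i
    using z by (auto simp: sym_simplex_def)
  have path: "sym_path k 0 z = (\<Sum>i\<le>k div 2. sym_weight k i * chord (z i)) - chord a"
    by (simp add: sym_path_def a_def)
  have dbl: "z i \<le> 2 ^ i * a" if "i \<le> n" for i
    using that
  proof (induction i rule: less_induct)
    case (less i)
    have "(\<Sum>l<i. z l) \<le> (\<Sum>l<i. 2 ^ l * a)" using less by (intro sum_mono) auto
    then show ?case using growth[of i] less.prems
      by (simp add: sum_doubling n_def a_def left_diff_distrib)
  qed
  show thesis
  proof (cases "a \<le> M_up k")
    case True
    \<comment> \<open>If all gaps grew as fast as allowed, they would still have to fill the circle;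
      the resulting coefficient of \<open>a\<close> is the denominator in
      \<open>m_low_eq\<close>.\<close>
    have "2 * pi \<le> (\<Sum>i\<le>k div 2. sym_weight k i * (if i < n then 2 ^ i * a else 2 ^ n * a))"
      unfolding tot[symmetric]
    proof (intro sum_mono mult_left_mono sym_weight_nonneg)
      fix i assume "i \<in> {..k div 2}"
      then show "z i \<le> (if i < n then 2 ^ i * a else 2 ^ n * a)"
        using dbl[of i] by (cases "i = n") (auto simp: n_def)
    qed
    also have "\<dots> = 2 * (\<Sum>i<n. 2 ^ i * a) + (real k + 1 - 2 * real n) * (2 ^ n * a)"
      by (rule sum_sym_weight_if) (simp add: n_def)
    also have "\<dots> = (2 ^ n * (real k - 2 * real n + 3) - 2) * a"
      unfolding sum_doubling by (simp add: algebra_simps)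
    finally have low: "m_low k \<le> a"
      using threshold_denominator(2)[of n k] by (simp add: m_low_eq[OF k] n_def divide_le_eq mult.commute)
    define j where "j = j_index k a"
    have j: "1 \<le> j" "j \<le> k div 2" "2 ^ (j - 1) * a \<le> mid_gap k j a" "mid_gap k j a \<le> 2 ^ j * a"
      unfolding j_def using j_index_spec[OF k low True] by auto
    have apos: "0 < a" using low m_low_pos[OF k] by simp
    have gap_pos: "0 \<le> opt_gap k j a i" for i
      using apos j(3) order_trans[of 0 "2 ^ (j - 1) * a" "mid_gap k j a"] by (simp add: opt_gap_def)
    have mid2: "mid_gap k j a \<le> 2 * pi"
      using weighted_le_2pi[OF gap_pos opt_gap_total[OF j(2)], of "k div 2"] j(2) by (simp add: opt_gap_def)
    have "(\<Sum>i\<le>k div 2. sym_weight k i * chord (z i)) \<le> (\<Sum>i\<le>k div 2. sym_weight k i * chord (opt_gap k j a i))"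
    proof (rule weighted_chord_le[OF z0 tot gap_pos opt_gap_total[OF j(2)]])
      fix i assume i: "i \<le> k div 2"
      \<comment> \<open>The multiplier is the slope at the common gap. For \<open>i < j\<close> the
        slope is at least that and \<open>z i\<close> cannot exceed \<open>opt_gap\<close>; for the
        other indices the two sides agree.\<close>
      show "cos (opt_gap k j a i / 2) * (z i - opt_gap k j a i) \<le> cos (mid_gap k j a / 2) * (z i - opt_gap k j a i)"
      proof (cases "i < j")
        case True
        then have "(2::real) ^ i * a \<le> 2 ^ (j - 1) * a"
          using apos by (intro mult_right_mono power_increasing) auto
        then have "2 ^ i * a \<le> mid_gap k j a" using j(3) by simp
        then have "cos (mid_gap k j a / 2) \<le> cos (2 ^ i * a / 2)"
          using apos mid2 by (intro cos_monotone_0_pi_le) auto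
        then show ?thesis using True dbl[of i] i by (auto simp: opt_gap_def n_def intro!: mult_right_mono_neg)
      qed (simp add: opt_gap_def)
    qed
    then show thesis using that[OF low True] s_fun_eq[OF k low True] path by (simp add: j_def)
  next
    \<comment> \<open>For large \<open>z 0\<close> the regular polygon wins twice: its perimeter is
      maximal and the edge it omits is no longer than the one over \<open>a\<close>.\<close>
    case False
    let ?M = "M_up k"
    have jM: "j_index k ?M = 1" by (simp add: j_index_def)
    have "1 \<le> k div 2" using k by simp
    then have M_tot: "(\<Sum>i\<le>k div 2. sym_weight k i * opt_gap k 1 ?M i) = 2 * pi" by (rule opt_gap_total)
    have gapM: "opt_gap k 1 ?M i = ?M" for i using mid_gap_M_up[OF k] by (simp add: opt_gap_def)
    have "(\<Sum>i\<le>k div 2. sym_weight k i * chord (z i)) \<le> (\<Sum>i\<le>k div 2. sym_weight k i * chord (opt_gap k 1 ?M i))"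
      by (rule weighted_chord_le[OF z0 tot _ M_tot, where m = "cos (?M / 2)"])
        (use M_up_pos[of k] in \<open>auto simp: gapM[simplified]\<close>)
    moreover have "chord ?M \<le> chord a"
    proof (rule chord_mono)
      have "sym_weight k 0 * z 0 \<le> (\<Sum>i\<le>k div 2. sym_weight k i * z i)"
        using z0 sym_weight_nonneg by (intro member_le_sum) auto
      then have "2 * a \<le> 2 * pi" using tot by (simp add: sym_weight_0[OF k] a_def)
      then show "?M + a \<le> 2 * pi" using False by simp
    qed (use M_up_pos[of k] False in auto)
    moreover note s_fun_eq[OF k m_low_le_M_up[OF k] order_refl]
    ultimately show thesis using that[OF m_low_le_M_up[OF k] order_refl] path by (simp add: jM)
  qed
qed

section \<open>Equality of supremum and maximum\<close>

theorem theorem5: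
  fixes k :: nat
  assumes "k \<ge> 2"
  shows "c_sup k = s_max k"
proof -
  obtain z where z: "z \<in> sym_simplex k" "\<And>b. b \<le> k div 2 \<Longrightarrow> z b \<le> z 0 + (\<Sum>i<b. z i)"
    and max: "\<And>z'. z' \<in> sym_simplex k \<Longrightarrow> \<exists>b\<le>k div 2. sym_path k b z' \<le> sym_path k 0 z"
    using sym_path_maximiser[OF assms] by blast
  obtain \<alpha> where \<alpha>: "m_low k \<le> \<alpha>" "\<alpha> \<le> M_up k" "sym_path k 0 z \<le> s_fun k \<alpha>"
    using sym_path_le_s_fun[OF assms z] by blast
  have upper: "min_path k T \<le> s_fun k \<alpha>" if T: "T \<in> {1..k} \<rightarrow>\<^sub>E unit_circle" for T
  proof -
    obtain z' where "z' \<in> sym_simplex k" "\<And>b. b \<le> k div 2 \<Longrightarrow> min_path k T \<le> sym_path k b z'"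
      using min_path_le_sym_path[OF assms T] by blast
    then show ?thesis using max[of z'] \<alpha>(3) by force
  qed
  have lower: "s_fun k \<beta> \<le> c_sup k" if \<beta>: "\<beta> \<in> {m_low k..M_up k}" for \<beta>
  proof -
    obtain T where "T \<in> {1..k} \<rightarrow>\<^sub>E unit_circle" "s_fun k \<beta> \<le> min_path k T"
      using exists_config_ge_s_fun[OF assms, of \<beta>] \<beta> by auto
    then show ?thesis unfolding c_sup_def
      by (intro cSUP_upper2) (auto intro!: bdd_aboveI2[of _ _ "s_fun k \<alpha>"] upper)
  qed
  have "c_sup k \<le> s_fun k \<alpha>" unfolding c_sup_def
    using exists_config_ge_s_fun[OF assms \<alpha>(1,2)] by (intro cSUP_least upper) auto
  \<comment> \<open>The value at \<alpha> bounds every \<open>min_path\<close> and is itself a lower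
    bound for the supremum. As no value of \<open>s_fun\<close> on the interval exceeds
    \<open>c_sup k\<close>, it is also the greatest one.\<close>
  then have "c_sup k = s_fun k \<alpha>" using lower[of \<alpha>] \<alpha> by simp
  then have "s_max k = c_sup k"
    unfolding s_max_def using \<alpha> lower by (intro Greatest_equality) auto
  then show ?thesis by simp
qed

end
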